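(* Let $H$ be a separable (infinite-dimensional, complex) Hilbert space with scalar product $\langle\cdot,\cdot\rangle$, let $\{e_n\}_{n=1}^{\infty}$ be a Riesz basis of $H$, let $T\in B(H)$ be the right shift operator $Te_n=e_{n+1}$, and let $k\in\mathbb{N}$. Then the space $H_k(\{e_n\})$ has the following properties. 1. $\overline{\mathrm{Lin}}\{e_n\}_{n=1}^{\infty}=H_k(\{e_n\})$. 2. $\{e_n\}_{n=1}^{\infty}$ does not form a (Schauder) basis of $H_k(\{e_n\})$. 3. $\{e_n\}_{n=1}^{\infty}$ has a unique biorthogonal system in $H_k(\{e_n\})$ (with respect to $\langle\cdot,\cdot\rangle_k$), namely $\{\chi_n=(I-T)^{-k}(I-T^* )^{-k}e_n^*\}_{n=1}^{\infty}$, where $\{e_n^*\}\subset H$ is determined by $\langle e_n,e_m^*\rangle=\delta_n^m$. 4. $\{\chi_n\}_{n=1}^{\infty}$ is a uniformly minimal sequence in $H_k(\{e_n\})$, while $\{e_n\}_{n=1}^{\infty}$ is minimal but not uniformly minimal in $H_k(\{e_n\})$. 5. $H\subset H_1(\{e_n\})\subset H_2(\{e_n\})\subset H_3(\{e_n\})\subset\dots$. 6. $H_k(\{e_n\})$ is a separable Hilbert space, isomorphic to $\ell_2$. 7. $H_k(\{e_n\})$ has an orthonormal basis. 8. The set $L=\bigl\{x=(\mathfrak{f})\sum_{n=1}^{\infty}c_ne_n\in H_k(\{e_n\}):\ \{c_n\}_{n=1}^{\infty}\in\ell_2(\Delta^k)\cap c_0\bigr\}$, where $c_0$ is the space of sequences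 tending to zero, is not a closed subspace of $H_k(\{e_n\})$.
   Context: For a sequence $\{c_n\}_{n=1}^\infty$ put $c_{m}=0$ for all integers $m\le0$ and $\Delta^kc_n=\sum_{j=0}^k(-1)^j\binom{k}{j}c_{n-j}$, $n\ge1$; $\ell_2(\Delta^k)$ is the set of complex sequences with $\{\Delta^kc_n\}_{n=1}^\infty\in\ell_2$. $(\mathfrak{f})\sum_{n=1}^\infty c_ne_n$ denotes a formal series, i.e. it is identified with its coefficient sequence (no convergence is required). $H_k(\{e_n\})$ is the space of formal series $x=(\mathfrak{f})\sum_{n=1}^\infty c_ne_n$ with $\{c_n\}\in\ell_2(\Delta^k)$, with norm $\|x\|_k=\bigl\|\sum_{n=1}^\infty(\Delta^kc_n)e_n\bigr\|$ ($\|\cdot\|$ the norm of $H$) and scalar product $\langle x,y\rangle_k=\langle(I-T)^kx,(I-T)^ky\rangle$, where for $x=(\mathfrak{f})\sum c_ne_n\in H_k(\{e_n\})$ one puts $(I-T)^kx=\sum_{n=1}^\infty(\Delta^kc_n)e_n\in H$. Equivalently it is the completion of $H$ in the norm $\|(I-T)^kx\|$. Elements $x=\sum c_ne_n$ of $H$ (in particular $e_n$) are identified with the formal series with the same coefficients. In item 3, $(I-T)^{-k}:H\to H_k(\{e_n\})$ is the inverse of the isometric bijection $(I-T)^k:H_k(\{e_n\})\to H$ just described; $T^*$ is the Hilbert-space adjoint of $T$ in $H$, and $(I-T^* )^{-k}e_n^*$ is the unique element of $H$ mapped to $e_n^*$ by the (injective) operator $(I-T^* )^k$. A Riesz basis is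 the image of an orthonormal basis under a bounded, boundedly invertible operator. A sequence $\{x_n\}$ in a Hilbert space is minimal if $\mathrm{dist}(x_n,\overline{\mathrm{Lin}}\{x_j\}_{j\ne n})>0$ for every $n$, and uniformly minimal if $\inf_n\mathrm{dist}(x_n,\overline{\mathrm{Lin}}\{x_j\}_{j\neq n})>0$. "Isomorphic" means linearly homeomorphic. *)

theory Defs
  imports "HOL-Analysis.Analysis" "HOL-Library.Function_Algebras"
begin

section \<open>Complex Hilbert spaces with an explicit carrier\<close>

text \<open>
  The spaces below depend on a number and on a sequence of vectors, so a space is
  a subspace of an ambient complex vector space, given by its carrier. Addition is that of the
  type; for sequences it is the pointwise one of \<^theory>\<open>HOL-Library.Function_Algebras\<close>.
\<close>

record 'a cips =
  vecs :: "'a set"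
  scl :: "complex \<Rightarrow> 'a \<Rightarrow> 'a"
  cip :: "'a \<Rightarrow> 'a \<Rightarrow> complex"

text \<open>The scalar product is linear in its first argument.\<close>

locale complex_inner_space = vector_space "scl V" for V :: "'a::ab_group_add cips" +
  assumes subspace_vecs: "subspace (vecs V)"
    and cip_commute: "\<lbrakk>x \<in> vecs V; y \<in> vecs V\<rbrakk> \<Longrightarrow> cip V y x = cnj (cip V x y)"
    and cip_add_left:
      "\<lbrakk>x \<in> vecs V; y \<in> vecs V; z \<in> vecs V\<rbrakk> \<Longrightarrow> cip V (x + y) z = cip V x z + cip V y z"
    and cip_scl_left:
      "\<lbrakk>x \<in> vecs V; y \<in> vecs V\<rbrakk> \<Longrightarrow> cip V (scl V a x) y = a * cip V x y"
    and cip_pos: "\<lbrakk>x \<in> vecs V; x \<noteq> 0\<rbrakk> \<Longrightarrow> Re (cip V x x) > 0"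

definition vnorm :: "'a cips \<Rightarrow> 'a \<Rightarrow> real" where
  "vnorm V x = sqrt (Re (cip V x x))"

text \<open>
  The locale \<^locale>\<open>Metric_space\<close> requires nonnegativity and symmetry of the distance on
  the whole type, hence the value 0 outside the carrier.
\<close>

definition vdist :: "'a::ab_group_add cips \<Rightarrow> 'a \<Rightarrow> 'a \<Rightarrow> real" where
  "vdist V x y = (if x \<in> vecs V \<and> y \<in> vecs V then vnorm V (x - y) else 0)"

definition vtop :: "'a::ab_group_add cips \<Rightarrow> 'a topology" where
  "vtop V = Metric_space.mtopology (vecs V) (vdist V)"

locale complex_hilbert_space = complex_inner_space +
  assumes complete: "Metric_space.mcomplete (vecs V) (vdist V)"

definition lin :: "'a::ab_group_add cips \<Rightarrow> 'a set \<Rightarrow> 'a set" where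
  "lin V S = module.span (scl V) S"

definition closed_lin :: "'a::ab_group_add cips \<Rightarrow> 'a set \<Rightarrow> 'a set" where
  "closed_lin V S = vtop V closure_of lin V S"

definition infinite_dimensional :: "'a::ab_group_add cips \<Rightarrow> bool" where
  "infinite_dimensional V \<longleftrightarrow> \<not> (\<exists>B. finite B \<and> B \<subseteq> vecs V \<and> lin V B = vecs V)"

section \<open>Operators\<close>

definition linear_map :: "'a::ab_group_add cips \<Rightarrow> 'b::ab_group_add cips \<Rightarrow> ('a \<Rightarrow> 'b) \<Rightarrow> bool" where
  "linear_map V W f \<longleftrightarrow>
     (\<forall>x\<in>vecs V. f x \<in> vecs W) \<and>
     (\<forall>x\<in>vecs V. \<forall>y\<in>vecs V. f (x + y) = f x + f y) \<and>
     (\<forall>a. \<forall>x\<in>vecs V. f (scl V a x) = scl W a (f x))"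

definition bounded_op :: "'a::ab_group_add cips \<Rightarrow> 'b::ab_group_add cips \<Rightarrow> ('a \<Rightarrow> 'b) \<Rightarrow> bool" where
  "bounded_op V W f \<longleftrightarrow> linear_map V W f \<and> (\<exists>K. \<forall>x\<in>vecs V. vnorm W (f x) \<le> K * vnorm V x)"

definition isomorphic :: "'a::ab_group_add cips \<Rightarrow> 'b::ab_group_add cips \<Rightarrow> bool" where
  "isomorphic V W \<longleftrightarrow> (\<exists>f. linear_map V W f \<and> homeomorphic_map (vtop V) (vtop W) f)"

definition hilbert_adjoint :: "'a cips \<Rightarrow> ('a \<Rightarrow> 'a) \<Rightarrow> 'a \<Rightarrow> 'a" where
  "hilbert_adjoint V A y = (THE z. z \<in> vecs V \<and> (\<forall>x\<in>vecs V. cip V (A x) y = cip V x z))"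

section \<open>Sequences of vectors\<close>

definition series_to :: "'a::ab_group_add cips \<Rightarrow> (nat \<Rightarrow> 'a) \<Rightarrow> (nat \<Rightarrow> complex) \<Rightarrow> 'a \<Rightarrow> bool" where
  "series_to V x c v \<longleftrightarrow> limitin (vtop V) (\<lambda>N. \<Sum>n<N. scl V (c n) (x n)) v sequentially"

definition series_sum :: "'a::ab_group_add cips \<Rightarrow> (nat \<Rightarrow> 'a) \<Rightarrow> (nat \<Rightarrow> complex) \<Rightarrow> 'a" where
  "series_sum V x c = (THE v. series_to V x c v)"

definition schauder_basis :: "'a::ab_group_add cips \<Rightarrow> (nat \<Rightarrow> 'a) \<Rightarrow> bool" where
  "schauder_basis V x \<longleftrightarrow> (\<forall>n. x n \<in> vecs V) \<and> (\<forall>v\<in>vecs V. \<exists>!c. series_to V x c v)"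

definition biorthogonal :: "'a cips \<Rightarrow> (nat \<Rightarrow> 'a) \<Rightarrow> (nat \<Rightarrow> 'a) \<Rightarrow> bool" where
  "biorthogonal V x y \<longleftrightarrow>
     (\<forall>n. y n \<in> vecs V) \<and> (\<forall>n m. cip V (x n) (y m) = (if n = m then 1 else 0))"

definition dual_system :: "'a cips \<Rightarrow> (nat \<Rightarrow> 'a) \<Rightarrow> nat \<Rightarrow> 'a" where
  "dual_system V x = (THE y. biorthogonal V x y)"

definition orthonormal_basis :: "'a::ab_group_add cips \<Rightarrow> (nat \<Rightarrow> 'a) \<Rightarrow> bool" where
  "orthonormal_basis V u \<longleftrightarrow>
     (\<forall>n. u n \<in> vecs V) \<and> (\<forall>n m. cip V (u n) (u m) = (if n = m then 1 else 0)) \<and>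
     closed_lin V (range u) = vecs V"

definition riesz_basis :: "'a::ab_group_add cips \<Rightarrow> (nat \<Rightarrow> 'a) \<Rightarrow> bool" where
  "riesz_basis V x \<longleftrightarrow>
     (\<exists>u A B. orthonormal_basis V u \<and> bounded_op V V A \<and> bounded_op V V B \<and>
        (\<forall>v\<in>vecs V. B (A v) = v \<and> A (B v) = v) \<and> (\<forall>n. x n = A (u n)))"

definition dist_to_set :: "'a::ab_group_add cips \<Rightarrow> 'a \<Rightarrow> 'a set \<Rightarrow> real" where
  "dist_to_set V x S = (INF y\<in>S. vdist V x y)"

definition minimal_seq :: "'a::ab_group_add cips \<Rightarrow> (nat \<Rightarrow> 'a) \<Rightarrow> bool" where
  "minimal_seq V x \<longleftrightarrow> (\<forall>n. x n \<in> vecs V) \<and>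
     (\<forall>n. dist_to_set V (x n) (closed_lin V (x ` {j. j \<noteq> n})) > 0)"

definition uniformly_minimal_seq :: "'a::ab_group_add cips \<Rightarrow> (nat \<Rightarrow> 'a) \<Rightarrow> bool" where
  "uniformly_minimal_seq V x \<longleftrightarrow> (\<forall>n. x n \<in> vecs V) \<and>
     (INF n. dist_to_set V (x n) (closed_lin V (x ` {j. j \<noteq> n}))) > 0"

section \<open>The spaces of formal series\<close>

definition ell2 :: "(nat \<Rightarrow> complex) cips" where
  "ell2 = \<lparr> vecs = {c. summable (\<lambda>n. (cmod (c n))\<^sup>2)},
            scl = (\<lambda>a c n. a * c n),
            cip = (\<lambda>c d. \<Sum>n. c n * cnj (d n)) \<rparr>"

text \<open>
  Sequences are indexed from 0: the term with index \<open>n\<close> here is the term with index \<open>n + 1\<close>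
  of a sequence starting at 1. Terms with negative index are 0.
\<close>

definition bdiff :: "nat \<Rightarrow> (nat \<Rightarrow> complex) \<Rightarrow> nat \<Rightarrow> complex" where
  "bdiff k c n = (\<Sum>j\<le>k. (- 1) ^ j * of_nat (k choose j) * (if j \<le> n then c (n - j) else 0))"

text \<open>
  A formal series is its coefficient sequence. The map \<open>coeff_seq H e\<close> identifies the elements of
  \<open>H\<close> with formal series, and \<open>diff_op H e k\<close> is the operator \<open>(I - T)\<^sup>k\<close> from formal
  series to \<open>H\<close>.
\<close>

definition coeff_seq :: "'a::ab_group_add cips \<Rightarrow> (nat \<Rightarrow> 'a) \<Rightarrow> 'a \<Rightarrow> nat \<Rightarrow> complex" where
  "coeff_seq H e v = (THE c. series_to H e c v)"

definition diff_op :: "'a::ab_group_add cips \<Rightarrow> (nat \<Rightarrow> 'a) \<Rightarrow> nat \<Rightarrow> (nat \<Rightarrow> complex) \<Rightarrow> 'a" where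
  "diff_op H e k c = series_sum H e (bdiff k c)"

definition Hk :: "'a::ab_group_add cips \<Rightarrow> (nat \<Rightarrow> 'a) \<Rightarrow> nat \<Rightarrow> (nat \<Rightarrow> complex) cips" where
  "Hk H e k = \<lparr> vecs = {c. bdiff k c \<in> vecs ell2},
                scl = (\<lambda>a c n. a * c n),
                cip = (\<lambda>c d. cip H (diff_op H e k c) (diff_op H e k d)) \<rparr>"

definition adj_diff_op :: "'a::ab_group_add cips \<Rightarrow> ('a \<Rightarrow> 'a) \<Rightarrow> nat \<Rightarrow> 'a \<Rightarrow> 'a" where
  "adj_diff_op H T k = (\<lambda>x. x - hilbert_adjoint H T x) ^^ k"

definition chi :: "'a::ab_group_add cips \<Rightarrow> (nat \<Rightarrow> 'a) \<Rightarrow> ('a \<Rightarrow> 'a) \<Rightarrow> nat \<Rightarrow> nat \<Rightarrow> nat \<Rightarrow> complex" where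
  "chi H e T k n =
     inv_into (vecs (Hk H e k)) (diff_op H e k)
       (inv_into (vecs H) (adj_diff_op H T k) (dual_system H e n))"

end

theory Submission
  imports Defs
begin

text \<open>
  The coefficient map identifies \<open>H\<close> with \<open>ell2\<close> up to equivalence of norms (Riesz-Fischer),
  and \<open>bdiff k\<close> is bijective on all sequences, with the \<open>k\<close>-fold partial sum as inverse. So
  \<open>Hk H e k\<close> is isometric to \<open>H\<close> through \<open>diff_op\<close> and isomorphic to \<open>ell2\<close> through
  \<open>bdiff k\<close>, and questions about it become questions about the sequences
  \<open>bdiff k (unit_seq n)\<close> in \<open>ell2\<close>. Linear ramps and tents have small first differences: ramps
  give density, tents the failure of uniform minimality. The constant sequence 1 lies in
  \<open>Hk H e k\<close> but does not tend to 0, which excludes a Schauder expansion and shows that the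
  dense subspace of null sequences is proper, hence not closed. The \<open>n\<close>-th entry of the \<open>k\<close>-fold
  partial sum is a bounded functional on \<open>ell2\<close>; its Riesz representative in \<open>H\<close> is the preimage
  of the dual vector under \<open>(I - T*)^k\<close>.
\<close>

section \<open>Inner product spaces with a carrier\<close>

text \<open>The obstacle is that partial summation is unbounded on \<open>ell2\<close>: the sum of a
  unit vector is already an eventually constant sequence. For \<open>k \<ge> 1\<close> the range of
  \<open>bdiff k\<close> on \<open>ell2\<close> is therefore dense but proper, and no estimate
  inverts the difference inside \<open>ell2\<close>. What survives is that one entry of the sum
  involves finitely many coordinates, so each coefficient functional stays bounded, with a bound
  that depends on the entry. This asymmetry separates the two biorthogonal systems: the unit vectors
  are bounded in norm, which makes their partners \<open>chi\<close> uniformly minimal, while the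
  tents exclude the same conclusion in the other direction. The operator \<open>T\<close> is given
  only by its values on the basis and by its boundedness, so identities about it are equalities of
  bounded functionals, checked on the basis and extended by density.\<close>

context complex_inner_space
begin

lemma vecs_zero: "0 \<in> vecs V"
  and vecs_add: "x \<in> vecs V \<Longrightarrow> y \<in> vecs V \<Longrightarrow> x + y \<in> vecs V"
  and vecs_diff: "x \<in> vecs V \<Longrightarrow> y \<in> vecs V \<Longrightarrow> x - y \<in> vecs V"
  and vecs_scl: "x \<in> vecs V \<Longrightarrow> scl V a x \<in> vecs V"
  and vecs_sum: "(\<And>i. i \<in> I \<Longrightarrow> g i \<in> vecs V) \<Longrightarrow> sum g I \<in> vecs V"
  using subspace_vecs by (auto intro: subspace_0 subspace_add subspace_diff subspace_scale subspace_sum)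

lemma cip_zero_left: "y \<in> vecs V \<Longrightarrow> cip V 0 y = 0"
  using cip_scl_left[of 0 y 0] vecs_zero by simp

lemma cip_zero_right: "y \<in> vecs V \<Longrightarrow> cip V y 0 = 0"
  using cip_commute[of 0 y] vecs_zero cip_zero_left by simp

lemma cip_diff_left:
  assumes "x \<in> vecs V" "y \<in> vecs V" "z \<in> vecs V"
  shows "cip V (x - y) z = cip V x z - cip V y z"
  using cip_add_left[of "x - y" y z] assms vecs_diff by simp

lemma cip_add_right:
  assumes "x \<in> vecs V" "y \<in> vecs V" "z \<in> vecs V"
  shows "cip V x (y + z) = cip V x y + cip V x z"
  using cip_add_left[of y z x] cip_commute[of "y + z" x] cip_commute[of y x] cip_commute[of z x] assms vecs_add
  by simp

lemma cip_diff_right: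
  assumes "x \<in> vecs V" "y \<in> vecs V" "z \<in> vecs V"
  shows "cip V x (y - z) = cip V x y - cip V x z"
  using cip_add_right[of x "y - z" z] assms vecs_diff by simp

lemma cip_scl_right:
  assumes "x \<in> vecs V" "y \<in> vecs V"
  shows "cip V x (scl V a y) = cnj a * cip V x y"
  using cip_scl_left[of y x a] cip_commute[of "scl V a y" x] cip_commute[of y x] assms vecs_scl
  by simp

lemma cip_sum_left:
  assumes "\<And>i. i \<in> I \<Longrightarrow> g i \<in> vecs V" "y \<in> vecs V"
  shows "cip V (sum g I) y = (\<Sum>i\<in>I. cip V (g i) y)"
  using assms
  by (induction I rule: infinite_finite_induct) (simp_all add: cip_zero_left cip_add_left vecs_sum)

lemma Re_cip_nonneg: "x \<in> vecs V \<Longrightarrow> 0 \<le> Re (cip V x x)"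
  using cip_pos[of x] cip_zero_left[of 0] vecs_zero by (cases "x = 0") (auto intro: less_imp_le)

lemma vnorm_nonneg: "x \<in> vecs V \<Longrightarrow> 0 \<le> vnorm V x"
  by (simp add: vnorm_def Re_cip_nonneg)

lemma vnorm_zero: "vnorm V 0 = 0"
  by (simp add: vnorm_def cip_zero_left vecs_zero)

lemma vnorm_pos: "x \<in> vecs V \<Longrightarrow> x \<noteq> 0 \<Longrightarrow> 0 < vnorm V x"
  by (simp add: vnorm_def cip_pos)

lemma vnorm_eq_0_iff: "x \<in> vecs V \<Longrightarrow> vnorm V x = 0 \<longleftrightarrow> x = 0"
  using vnorm_pos[of x] vnorm_zero by fastforce

lemma vnorm_squared: "x \<in> vecs V \<Longrightarrow> (vnorm V x)\<^sup>2 = Re (cip V x x)"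
  by (simp add: vnorm_def Re_cip_nonneg)

lemma vnorm_scl:
  assumes "x \<in> vecs V"
  shows "vnorm V (scl V a x) = cmod a * vnorm V x"
proof -
  have "cip V (scl V a x) (scl V a x) = complex_of_real ((cmod a)\<^sup>2) * cip V x x"
    unfolding complex_norm_square
    using assms by (simp add: cip_scl_left cip_scl_right vecs_scl)
  then show ?thesis
    by (simp add: vnorm_def real_sqrt_mult)
qed

lemma vnorm_diff_squared:
  assumes "x \<in> vecs V" "y \<in> vecs V"
  shows "(vnorm V (x - y))\<^sup>2 = (vnorm V x)\<^sup>2 - 2 * Re (cip V x y) + (vnorm V y)\<^sup>2"
  using assms cip_commute[of x y]
  by (simp add: vnorm_squared vecs_diff cip_diff_left cip_diff_right)

lemma Cauchy_Schwarz:
  assumes "x \<in> vecs V" "y \<in> vecs V"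
  shows "cmod (cip V x y) \<le> vnorm V x * vnorm V y"
proof (cases "y = 0")
  case True
  then show ?thesis using assms by (simp add: cip_zero_right vnorm_zero)
next
  case False
  define c where "c = cip V x y"
  define b where "b = (vnorm V y)\<^sup>2"
  have b: "b > 0" using vnorm_pos[OF assms(2) False] by (simp add: b_def)
  \<comment> \<open>\<open>scl V a y\<close> is the orthogonal projection of \<open>x\<close> onto
    the line through \<open>y\<close>; the inequality is the nonnegativity of the squared distance
    from \<open>x\<close> to that line.\<close>
  define a where "a = c / of_real b"
  have "0 \<le> (vnorm V (x - scl V a y))\<^sup>2" by simp
  also have "\<dots> = (vnorm V x)\<^sup>2 - 2 * Re (cnj a * c) + (cmod a)\<^sup>2 * b"
    using assms by (simp add: vnorm_diff_squared vecs_scl cip_scl_right vnorm_scl c_def b_def power_mult_distrib)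
  also have "cnj a * c = of_real ((cmod c)\<^sup>2 / b)"
    by (simp add: a_def mult.commute flip: complex_norm_square)
  also have "(cmod a)\<^sup>2 * b = (cmod c)\<^sup>2 / b"
    using b by (simp add: a_def norm_divide power_divide power2_eq_square)
  finally have "(cmod c)\<^sup>2 / b \<le> (vnorm V x)\<^sup>2" by simp
  then have "(cmod c)\<^sup>2 \<le> (vnorm V x * vnorm V y)\<^sup>2"
    using b by (simp add: field_simps b_def)
  then show ?thesis
    unfolding c_def by (rule power2_le_imp_le) (simp add: assms vnorm_nonneg)
qed

lemma vnorm_minus_commute:
  assumes "x \<in> vecs V" "y \<in> vecs V"
  shows "vnorm V (x - y) = vnorm V (y - x)"
  using vnorm_scl[OF vecs_diff[OF assms], of "-1"] by simp

lemma vnorm_triangle: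
  assumes "x \<in> vecs V" "y \<in> vecs V"
  shows "vnorm V (x - y) \<le> vnorm V x + vnorm V y"
proof (rule power2_le_imp_le)
  have "- Re (cip V x y) \<le> vnorm V x * vnorm V y"
    using Cauchy_Schwarz[OF assms] complex_Re_le_cmod[of "- cip V x y"] by simp
  then show "(vnorm V (x - y))\<^sup>2 \<le> (vnorm V x + vnorm V y)\<^sup>2"
    using assms by (simp add: vnorm_diff_squared power2_sum)
qed (simp add: assms vnorm_nonneg)

lemma vnorm_triangle_add:
  assumes "x \<in> vecs V" "y \<in> vecs V"
  shows "vnorm V (x + y) \<le> vnorm V x + vnorm V y"
  using vnorm_triangle[of x "0 - y"] vnorm_minus_commute[of 0 y] assms
  by (simp add: vecs_diff vecs_zero del: diff_0)
    (simp add: vecs_diff[OF vecs_zero])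

section \<open>The metric of the norm\<close>

lemma Metric_space_vdist: "Metric_space (vecs V) (vdist V)"
proof
  fix x y z assume xyz: "x \<in> vecs V" "y \<in> vecs V" "z \<in> vecs V"
  show "vdist V x z \<le> vdist V x y + vdist V y z"
    using vnorm_triangle_add[of "x - y" "y - z"] xyz by (simp add: vdist_def vecs_diff)
qed (auto simp: vdist_def vnorm_nonneg vecs_diff vnorm_minus_commute vnorm_eq_0_iff)

sublocale metric: Metric_space "vecs V" "vdist V"
  by (rule Metric_space_vdist)

lemma topspace_vtop: "topspace (vtop V) = vecs V"
  by (simp add: vtop_def)

text \<open>Since \<open>vdist\<close> is 0 off the carrier, small distances alone say nothing about
  points outside it. The clause on eventual membership removes this default value from the
  limit.\<close>

lemma limitin_vtop_iff:
  "limitin (vtop V) f l F \<longleftrightarrow>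
     l \<in> vecs V \<and> eventually (\<lambda>i. f i \<in> vecs V) F \<and> ((\<lambda>i. vnorm V (f i - l)) \<longlongrightarrow> 0) F"
proof -
  have "((\<lambda>i. vdist V (f i) l) \<longlongrightarrow> 0) F \<longleftrightarrow> ((\<lambda>i. vnorm V (f i - l)) \<longlongrightarrow> 0) F"
    if "l \<in> vecs V" "eventually (\<lambda>i. f i \<in> vecs V) F"
    by (rule tendsto_cong) (use that in \<open>auto simp: vdist_def elim!: eventually_mono\<close>)
  then show ?thesis
    unfolding vtop_def metric.limitin_metric_dist_null by blast
qed

lemma closure_of_vtop_iff:
  assumes "S \<subseteq> vecs V"
  shows "x \<in> vtop V closure_of S \<longleftrightarrow> x \<in> vecs V \<and> (\<forall>r>0. \<exists>y\<in>S. vnorm V (x - y) < r)"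
  using assms by (fastforce simp: vtop_def metric.metric_closure_of vdist_def)

section \<open>Closed linear spans\<close>

lemma lin_subset: "S \<subseteq> vecs V \<Longrightarrow> lin V S \<subseteq> vecs V"
  unfolding lin_def by (rule span_minimal[OF _ subspace_vecs])

lemma closed_lin_iff:
  assumes "S \<subseteq> vecs V"
  shows "x \<in> closed_lin V S \<longleftrightarrow> x \<in> vecs V \<and> (\<forall>r>0. \<exists>y\<in>lin V S. vnorm V (x - y) < r)"
  unfolding closed_lin_def by (rule closure_of_vtop_iff) (rule lin_subset[OF assms])

lemma closed_lin_subset: "closed_lin V S \<subseteq> vecs V"
  unfolding closed_lin_def by (metis closure_of_subset_topspace topspace_vtop)

lemma lin_subset_closed_lin: "S \<subseteq> vecs V \<Longrightarrow> lin V S \<subseteq> closed_lin V S"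
  unfolding closed_lin_def by (intro closure_of_subset) (simp add: lin_subset topspace_vtop)

lemma subspace_closed_lin:
  assumes S: "S \<subseteq> vecs V"
  shows "subspace (closed_lin V S)"
proof (rule subspaceI)
  show "0 \<in> closed_lin V S"
    using lin_subset_closed_lin[OF S] span_zero by (auto simp: lin_def)
next
  fix x y assume xy: "x \<in> closed_lin V S" "y \<in> closed_lin V S"
  then have vecs: "x \<in> vecs V" "y \<in> vecs V" using closed_lin_subset by auto
  have "\<exists>z\<in>lin V S. vnorm V (x + y - z) < r" if r: "r > 0" for r
  proof -
    obtain a b where ab: "a \<in> lin V S" "b \<in> lin V S" "vnorm V (x - a) < r / 2" "vnorm V (y - b) < r / 2"
      using xy r unfolding closed_lin_iff[OF S] by (meson half_gt_zero)
    then have "vnorm V ((x - a) + (y - b)) < r"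
      using vnorm_triangle_add[of "x - a" "y - b"] vecs lin_subset[OF S] by (auto simp: vecs_diff subset_iff)
    then show ?thesis
      using ab by (intro bexI[of _ "a + b"]) (auto simp: algebra_simps lin_def intro: span_add)
  qed
  then show "x + y \<in> closed_lin V S"
    using vecs by (auto simp: closed_lin_iff[OF S] vecs_add)
next
  fix a x assume x: "x \<in> closed_lin V S"
  then have vecs: "x \<in> vecs V" using closed_lin_subset by auto
  have "\<exists>z\<in>lin V S. vnorm V (scl V a x - z) < r" if r: "r > 0" for r
  proof -
    \<comment> \<open>Adding 1 to the denominator also covers \<open>a = 0\<close>.\<close>
    have "r / (cmod a + 1) > 0" using r by (simp add: add_nonneg_pos)
    then obtain y where y: "y \<in> lin V S" "vnorm V (x - y) < r / (cmod a + 1)"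
      using x closed_lin_iff[OF S] by blast
    then have xy: "x - y \<in> vecs V" using vecs lin_subset[OF S] by (auto simp: vecs_diff)
    have "vnorm V (scl V a x - scl V a y) = cmod a * vnorm V (x - y)"
      using vnorm_scl[OF xy] by (simp add: scale_right_diff_distrib)
    also have "\<dots> \<le> (cmod a + 1) * vnorm V (x - y)"
      using vnorm_nonneg[OF xy] by (simp add: algebra_simps)
    also have "\<dots> < r"
      using y(2) by (simp add: pos_less_divide_eq add_nonneg_pos mult.commute)
    finally show ?thesis
      using y by (intro bexI[of _ "scl V a y"]) (auto simp: lin_def intro: span_scale)
  qed
  then show "scl V a x \<in> closed_lin V S"
    using vecs by (auto simp: closed_lin_iff[OF S] vecs_scl)
qed

text \<open>A closed span is a closed subspace and so absorbs both spans and closures. Density can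
  thus be passed on by approximating generators only.\<close>

lemma closed_lin_minimal:
  assumes "S \<subseteq> vecs V" "R \<subseteq> closed_lin V S"
  shows "closed_lin V R \<subseteq> closed_lin V S"
proof -
  have "lin V R \<subseteq> closed_lin V S"
    unfolding lin_def using assms(2) by (rule span_minimal) (rule subspace_closed_lin[OF assms(1)])
  then show ?thesis
    unfolding closed_lin_def by (rule closure_of_minimal) simp
qed

text \<open>On the span the functional is zero, and the bound controls the error of approximating
  \<open>x\<close> from there. Applied to a difference of two bounded functionals, this extends an
  equality from a spanning set to its closed span; most identities below are obtained in this
  way.\<close>

lemma bounded_functional_vanish:
  fixes \<phi> :: "'a \<Rightarrow> complex"
  assumes S: "S \<subseteq> vecs V"
    and add: "\<And>x y. x \<in> vecs V \<Longrightarrow> y \<in> vecs V \<Longrightarrow> \<phi> (x + y) = \<phi> x + \<phi> y"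
    and scl: "\<And>a x. x \<in> vecs V \<Longrightarrow> \<phi> (scl V a x) = a * \<phi> x"
    and bound: "\<And>x. x \<in> vecs V \<Longrightarrow> cmod (\<phi> x) \<le> K * vnorm V x"
    and vanish: "\<And>x. x \<in> S \<Longrightarrow> \<phi> x = 0"
    and x: "x \<in> closed_lin V S"
  shows "\<phi> x = 0"
proof -
  have lin0: "y \<in> vecs V \<and> \<phi> y = 0" if "y \<in> lin V S" for y
    using that unfolding lin_def
  proof (induction rule: span_induct_alt)
    case base
    show ?case using scl[of 0 0] vecs_zero by simp
  next
    case (step c s y)
    then show ?case using S vanish[of s] by (auto simp: add scl vecs_add vecs_scl)
  qed
  have xV: "x \<in> vecs V" using x closed_lin_subset by blast
  have "cmod (\<phi> x) < e" if "e > 0" for e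
  proof -
    \<comment> \<open>The sign of \<open>K\<close> is not known, hence the absolute value, and
      \<open>K\<close> may be 0, hence the added 1.\<close>
    define r where "r = e / (\<bar>K\<bar> + 1)"
    have "r > 0" using that by (simp add: r_def)
    then obtain y where y: "y \<in> lin V S" "vnorm V (x - y) < r"
      using x closed_lin_iff[OF S] by blast
    have "\<phi> x = \<phi> (x - y) + \<phi> y"
      using lin0[OF y(1)] xV add[of "x - y" y] by (simp add: vecs_diff)
    then have "cmod (\<phi> x) \<le> K * vnorm V (x - y)"
      using bound[of "x - y"] lin0[OF y(1)] xV by (simp add: vecs_diff)
    also have "\<dots> \<le> \<bar>K\<bar> * vnorm V (x - y)"
      using lin0[OF y(1)] xV by (intro mult_right_mono vnorm_nonneg vecs_diff) auto
    also have "\<dots> \<le> \<bar>K\<bar> * r"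
      using y(2) by (intro mult_left_mono) auto
    also have "\<dots> < (\<bar>K\<bar> + 1) * r"
      using \<open>r > 0\<close> by simp
    also have "\<dots> = e"
      by (simp add: r_def)
    finally show ?thesis .
  qed
  then show ?thesis
    using norm_ge_zero by (metis less_irrefl zero_less_norm_iff)
qed

lemma cip_closed_lin_eq_0:
  assumes "S \<subseteq> vecs V" "g \<in> vecs V" "\<And>s. s \<in> S \<Longrightarrow> cip V s g = 0" "x \<in> closed_lin V S"
  shows "cip V x g = 0"
  using assms(1) _ _ _ assms(3,4)
  by (rule bounded_functional_vanish[where K = "vnorm V g" and S = S])
    (use assms(2) in \<open>auto simp: cip_add_left cip_scl_left mult.commute intro: order_trans[OF Cauchy_Schwarz]\<close>)

text \<open>By density \<open>g\<close> lies in the closed span of \<open>S\<close> and is therefore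
  orthogonal to itself.\<close>

lemma eq_0_of_orthogonal:
  assumes "S \<subseteq> vecs V" "closed_lin V S = vecs V" "g \<in> vecs V" "\<And>s. s \<in> S \<Longrightarrow> cip V s g = 0"
  shows "g = 0"
  using cip_closed_lin_eq_0[of S g g] assms cip_pos[of g] by auto

section \<open>Distances and minimality\<close>

lemma dist_to_set_ge:
  assumes "x \<in> vecs V" "z \<in> vecs V" "S \<subseteq> vecs V" "cip V x z = 1" "\<And>s. s \<in> S \<Longrightarrow> cip V s z = 0"
  shows "1 / vnorm V z \<le> dist_to_set V x (closed_lin V S)"
proof -
  have z: "vnorm V z > 0"
    using assms by (intro vnorm_pos) (auto simp: cip_zero_right)
  show ?thesis
    unfolding dist_to_set_def
  proof (rule cINF_greatest)
    show "closed_lin V S \<noteq> {}"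
      using lin_subset_closed_lin[OF assms(3)] span_zero unfolding lin_def by blast
  next
    fix y assume y: "y \<in> closed_lin V S"
    then have yV: "y \<in> vecs V" using closed_lin_subset by blast
    \<comment> \<open>Pairing with \<open>z\<close> annihilates the whole closed span, so it gives
      the same value 1 for every competitor \<open>y\<close>; Cauchy-Schwarz turns this into a lower
      bound for the distance.\<close>
    have "cip V (x - y) z = 1"
      using assms yV cip_closed_lin_eq_0[OF assms(3,2) _ y] by (simp add: cip_diff_left)
    then have "1 \<le> vnorm V (x - y) * vnorm V z"
      using Cauchy_Schwarz[of "x - y" z] yV assms by (simp add: vecs_diff)
    then show "1 / vnorm V z \<le> vdist V x y"
      using z assms yV by (simp add: vdist_def field_simps)
  qed
qed

lemma dist_to_set_le:
  assumes "x \<in> vecs V" "S \<subseteq> vecs V" "y \<in> closed_lin V S"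
  shows "dist_to_set V x (closed_lin V S) \<le> vnorm V (x - y)"
proof -
  have "dist_to_set V x (closed_lin V S) \<le> vdist V x y"
    unfolding dist_to_set_def
    by (rule cINF_lower[OF _ assms(3)]) (auto intro!: bdd_belowI[of _ 0])
  then show ?thesis
    using assms closed_lin_subset[of S] by (auto simp: vdist_def)
qed

lemma dist_to_set_nonneg:
  assumes "S \<subseteq> vecs V"
  shows "0 \<le> dist_to_set V x (closed_lin V S)"
  unfolding dist_to_set_def
  using lin_subset_closed_lin[OF assms] span_zero
  by (intro cINF_greatest) (auto simp: lin_def)

lemma minimal_seqI:
  assumes "\<And>n. x n \<in> vecs V" "biorthogonal V x y"
  shows "minimal_seq V x"
  unfolding minimal_seq_def
proof (intro conjI allI assms(1))
  fix n
  have y: "y n \<in> vecs V" "cip V (x n) (y n) = 1" "\<And>j. j \<noteq> n \<Longrightarrow> cip V (x j) (y n) = 0"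
    using assms(2) by (auto simp: biorthogonal_def)
  then have "vnorm V (y n) > 0"
    using assms(1) by (intro vnorm_pos) (auto simp: cip_zero_right)
  moreover have "1 / vnorm V (y n) \<le> dist_to_set V (x n) (closed_lin V (x ` {j. j \<noteq> n}))"
    using y assms(1) by (intro dist_to_set_ge) auto
  ultimately show "0 < dist_to_set V (x n) (closed_lin V (x ` {j. j \<noteq> n}))"
    by (smt (verit) divide_pos_pos)
qed

text \<open>The distance of \<open>x n\<close> from the span of the others is at least
  \<open>1 / vnorm V (y n)\<close>, so a common bound on the biorthogonal partners bounds all the
  distances from below at once.\<close>

lemma uniformly_minimal_seqI:
  assumes "\<And>n. x n \<in> vecs V" "biorthogonal V x y" "\<And>n. vnorm V (y n) \<le> K"
  shows "uniformly_minimal_seq V x"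
  unfolding uniformly_minimal_seq_def
proof (intro conjI allI assms(1))
  have n: "vnorm V (y n) > 0 \<and> 1 / vnorm V (y n) \<le> dist_to_set V (x n) (closed_lin V (x ` {j. j \<noteq> n}))" for n
  proof -
    have y: "y n \<in> vecs V" "cip V (x n) (y n) = 1" "\<And>j. j \<noteq> n \<Longrightarrow> cip V (x j) (y n) = 0"
      using assms(2) by (auto simp: biorthogonal_def)
    then have "vnorm V (y n) > 0"
      using assms(1) by (intro vnorm_pos) (auto simp: cip_zero_right)
    then show ?thesis using y assms(1) by (auto intro!: dist_to_set_ge)
  qed
  have K: "K > 0" using n[of 0] assms(3)[of 0] by linarith
  have "1 / K \<le> dist_to_set V (x m) (closed_lin V (x ` {j. j \<noteq> m}))" for m
    using n[of m] frac_le[of 1 1 "vnorm V (y m)" K] assms(3)[of m] by simp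
  then have "1 / K \<le> (INF m. dist_to_set V (x m) (closed_lin V (x ` {j. j \<noteq> m})))"
    by (intro cINF_greatest) auto
  then show "0 < (INF m. dist_to_set V (x m) (closed_lin V (x ` {j. j \<noteq> m})))"
    using K by (smt (verit) divide_pos_pos)
qed

text \<open>The infimum itself is the required \<open>r\<close>. It lies below each distance because
  the distances are bounded below by 0.\<close>

lemma uniformly_minimal_seqD:
  assumes "uniformly_minimal_seq V x"
  obtains r where "r > 0" "\<And>n. r \<le> dist_to_set V (x n) (closed_lin V (x ` {j. j \<noteq> n}))"
proof
  have x: "x n \<in> vecs V" for n using assms by (simp add: uniformly_minimal_seq_def)
  show "(INF n. dist_to_set V (x n) (closed_lin V (x ` {j. j \<noteq> n}))) > 0"
    using assms by (simp add: uniformly_minimal_seq_def)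
  show "(INF n. dist_to_set V (x n) (closed_lin V (x ` {j. j \<noteq> n})))
      \<le> dist_to_set V (x n) (closed_lin V (x ` {j. j \<noteq> n}))" for n
    by (rule cINF_lower) (use x in \<open>auto intro!: bdd_belowI[of _ 0] dist_to_set_nonneg\<close>)
qed

end

section \<open>Bounded operators and isomorphisms\<close>

locale bounded_map = V: complex_inner_space V + W: complex_inner_space W
  for V :: "'a::ab_group_add cips" and W :: "'b::ab_group_add cips" +
  fixes f :: "'a \<Rightarrow> 'b" and K :: real
  assumes linear: "linear_map V W f"
    and upper: "x \<in> vecs V \<Longrightarrow> vnorm W (f x) \<le> K * vnorm V x"
begin

lemma map_vecs: "x \<in> vecs V \<Longrightarrow> f x \<in> vecs W"
  and map_add: "x \<in> vecs V \<Longrightarrow> y \<in> vecs V \<Longrightarrow> f (x + y) = f x + f y"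
  and map_scl: "x \<in> vecs V \<Longrightarrow> f (scl V a x) = scl W a (f x)"
  using linear by (auto simp: linear_map_def)

lemma map_diff: "x \<in> vecs V \<Longrightarrow> y \<in> vecs V \<Longrightarrow> f (x - y) = f x - f y"
  using map_add[of "x - y" y] V.vecs_diff by (simp add: algebra_simps)

lemma map_zero: "f 0 = 0"
  using map_diff[of 0 0] V.vecs_zero by simp

lemma map_sum: "(\<And>i. i \<in> I \<Longrightarrow> g i \<in> vecs V) \<Longrightarrow> f (sum g I) = (\<Sum>i\<in>I. f (g i))"
  by (induction I rule: infinite_finite_induct) (simp_all add: map_zero map_add V.vecs_sum)

text \<open>The locale leaves the sign of \<open>K\<close> open (on the zero space it may be
  negative), while estimates that enlarge or divide by the constant need a nonnegative one.\<close>

lemma upper_abs: "x \<in> vecs V \<Longrightarrow> vnorm W (f x) \<le> \<bar>K\<bar> * vnorm V x"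
  using upper[of x] by (smt (verit) V.vnorm_nonneg mult_right_mono)

lemma continuous: "continuous_map (vtop V) (vtop W) f"
  unfolding vtop_def V.metric.metric_continuous_map[OF W.Metric_space_vdist]
proof (intro conjI ballI allI impI)
  show "f ` vecs V \<subseteq> vecs W" using map_vecs by blast
next
  fix a and e :: real assume a: "a \<in> vecs V" and e: "e > 0"
  show "\<exists>d>0. \<forall>x. x \<in> vecs V \<and> vdist V a x < d \<longrightarrow> vdist W (f a) (f x) < e"
  proof (intro exI conjI allI impI)
    show "e / (\<bar>K\<bar> + 1) > 0" using e by simp
    fix x assume x: "x \<in> vecs V \<and> vdist V a x < e / (\<bar>K\<bar> + 1)"
    have "vdist W (f a) (f x) \<le> \<bar>K\<bar> * vnorm V (a - x)"
      using a x upper_abs[of "a - x"] by (simp add: vdist_def map_vecs map_diff V.vecs_diff)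
    also have "\<dots> \<le> (\<bar>K\<bar> + 1) * vnorm V (a - x)"
      using a x V.vnorm_nonneg[of "a - x"] by (simp add: algebra_simps V.vecs_diff)
    also have "\<dots> < e"
      using a x by (auto simp: vdist_def pos_less_divide_eq mult.commute)
    finally show "vdist W (f a) (f x) < e" .
  qed
qed

lemma lin_image:
  assumes "S \<subseteq> vecs V"
  shows "lin W (f ` S) = f ` lin V S"
proof
  have "f ` lin V S \<subseteq> lin W (f ` S)"
  proof clarify
    fix x assume "x \<in> lin V S"
    then have "x \<in> vecs V \<and> f x \<in> lin W (f ` S)"
      unfolding lin_def
    proof (induction rule: V.span_induct_alt)
      case base
      show ?case using V.vecs_zero W.span_zero by (simp add: map_zero)
    next
      case (step c s y)
      then show ?case
        using assms by (auto simp: map_add map_scl V.vecs_add V.vecs_scl subsetD intro!: W.span_add[OF W.span_scale[OF W.span_base]])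
    qed
    then show "f x \<in> lin W (f ` S)" ..
  qed
  then show "f ` lin V S \<subseteq> lin W (f ` S)" .
  have "y \<in> f ` lin V S" if "y \<in> lin W (f ` S)" for y
    using that unfolding lin_def
  proof (induction rule: W.span_induct_alt)
    case base
    show ?case using V.span_zero map_zero by (metis image_eqI)
  next
    case (step c s y)
    then obtain t z where t: "t \<in> S" "s = f t" "z \<in> V.span S" "y = f z" by auto
    then have "scl W c s + y = f (scl V c t + z)"
      using assms V.lin_subset[OF assms] by (auto simp: lin_def map_add map_scl V.vecs_scl subsetD)
    then show ?case using t by (auto intro: V.span_add V.span_scale V.span_base)
  qed
  then show "lin W (f ` S) \<subseteq> f ` lin V S" by blast
qed

text \<open>Only continuity enters. The lemma therefore also serves the first difference on
  \<open>ell2\<close>, which is not bounded below, where the equality available for isomorphisms is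
  out of reach.\<close>

lemma closed_lin_image_subset:
  assumes "S \<subseteq> vecs V"
  shows "f ` closed_lin V S \<subseteq> closed_lin W (f ` S)"
  unfolding closed_lin_def lin_image[OF assms]
  by (rule continuous_map_image_closure_subset[OF continuous])

end

text \<open>Surjectivity and a lower bound are the primitive data; injectivity and a bounded inverse
  follow from them. Passing to the inverse exchanges \<open>K\<close> and \<open>L\<close>.\<close>

locale bounded_isomorphism = bounded_map V W f K
  for V :: "'a::ab_group_add cips" and W :: "'b::ab_group_add cips" and f K +
  fixes L :: real
  assumes image: "f ` vecs V = vecs W"
    and lower: "x \<in> vecs V \<Longrightarrow> vnorm V x \<le> L * vnorm W (f x)"
begin

lemma inj: "inj_on f (vecs V)"
proof (rule inj_onI)
  fix x y assume xy: "x \<in> vecs V" "y \<in> vecs V" "f x = f y"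
  then have "vnorm V (x - y) \<le> L * vnorm W 0"
    using lower[of "x - y"] by (simp add: V.vecs_diff map_diff)
  then show "x = y"
    using V.vnorm_pos[of "x - y"] xy by (force simp: W.vnorm_zero V.vecs_diff)
qed

lemma bij: "bij_betw f (vecs V) (vecs W)"
  using inj image by (simp add: bij_betw_def)

lemma lower_abs: "x \<in> vecs V \<Longrightarrow> vnorm V x \<le> \<bar>L\<bar> * vnorm W (f x)"
  using lower[of x] by (smt (verit) W.vnorm_nonneg map_vecs mult_right_mono)

lemma tendsto_iff:
  assumes "l \<in> vecs V" "\<And>i. g i \<in> vecs V"
  shows "limitin (vtop W) (\<lambda>i. f (g i)) (f l) F \<longleftrightarrow> limitin (vtop V) g l F"
proof -
  have "((\<lambda>i. vnorm W (f (g i) - f l)) \<longlongrightarrow> 0) F \<longleftrightarrow> ((\<lambda>i. vnorm V (g i - l)) \<longlongrightarrow> 0) F"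
  proof
    assume "((\<lambda>i. vnorm W (f (g i) - f l)) \<longlongrightarrow> 0) F"
    then have "((\<lambda>i. \<bar>L\<bar> * vnorm W (f (g i) - f l)) \<longlongrightarrow> 0) F"
      by (rule tendsto_mult_right_zero)
    then show "((\<lambda>i. vnorm V (g i - l)) \<longlongrightarrow> 0) F"
      by (rule tendsto_0_le[where K = 1])
        (use assms lower_abs V.vnorm_nonneg in \<open>auto simp: map_diff[symmetric] V.vecs_diff intro!: always_eventually order_trans[OF _ abs_ge_self]\<close>)
  next
    assume "((\<lambda>i. vnorm V (g i - l)) \<longlongrightarrow> 0) F"
    then have "((\<lambda>i. \<bar>K\<bar> * vnorm V (g i - l)) \<longlongrightarrow> 0) F"
      by (rule tendsto_mult_right_zero)
    then show "((\<lambda>i. vnorm W (f (g i) - f l)) \<longlongrightarrow> 0) F"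
      by (rule tendsto_0_le[where K = 1])
        (use assms upper_abs W.vnorm_nonneg map_vecs in \<open>auto simp: map_diff[symmetric] V.vecs_diff intro!: always_eventually order_trans[OF _ abs_ge_self]\<close>)
  qed
  then show ?thesis
    using assms by (simp add: V.limitin_vtop_iff W.limitin_vtop_iff map_vecs)
qed

lemma inverse: "bounded_isomorphism W V (inv_into (vecs V) f) L K"
proof
  let ?g = "inv_into (vecs V) f"
  have g: "?g y \<in> vecs V \<and> f (?g y) = y" if "y \<in> vecs W" for y
    using that image by (simp add: f_inv_into_f inv_into_into)
  have gf: "?g (f x) = x" if "x \<in> vecs V" for x
    using that inj by (simp add: inv_into_f_f)
  show "linear_map W V ?g"
    unfolding linear_map_def
  proof (intro conjI ballI allI)
    fix x y assume "x \<in> vecs W" "y \<in> vecs W"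
    then show "?g (x + y) = ?g x + ?g y"
      using gf[of "?g x + ?g y"] g by (simp add: map_add V.vecs_add)
  next
    fix a x assume "x \<in> vecs W"
    then show "?g (scl W a x) = scl V a (?g x)"
      using gf[of "scl V a (?g x)"] g by (simp add: map_scl V.vecs_scl)
  qed (use g in blast)
  show "?g ` vecs W = vecs V"
    using g gf map_vecs by force
  show "vnorm V (?g x) \<le> L * vnorm W x" "vnorm W x \<le> K * vnorm V (?g x)" if "x \<in> vecs W" for x
    using g[OF that] upper[of "?g x"] lower[of "?g x"] by auto
qed

lemma homeomorphic: "homeomorphic_map (vtop V) (vtop W) f"
proof -
  interpret inv: bounded_isomorphism W V "inv_into (vecs V) f" L K by (rule inverse)
  have "homeomorphic_maps (vtop V) (vtop W) f (inv_into (vecs V) f)"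
    unfolding homeomorphic_maps_def
    using continuous inv.continuous inj image
    by (auto simp: V.topspace_vtop W.topspace_vtop f_inv_into_f)
  then show ?thesis by (rule homeomorphic_maps_imp_map)
qed

lemma isomorphic: "isomorphic V W"
  unfolding isomorphic_def using linear homeomorphic by blast

lemma separable_iff: "separable_space (vtop V) \<longleftrightarrow> separable_space (vtop W)"
  by (rule homeomorphic_separable_space) (rule homeomorphic_map_imp_homeomorphic_space[OF homeomorphic])

lemma closed_lin_image: "S \<subseteq> vecs V \<Longrightarrow> closed_lin W (f ` S) = f ` closed_lin V S"
  unfolding closed_lin_def
  using homeomorphic_map_closure_of[OF homeomorphic, of "lin V S"] V.lin_subset
  by (simp add: lin_image V.topspace_vtop)

lemma closed_lin_image_eq_iff:
  assumes "S \<subseteq> vecs V"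
  shows "closed_lin W (f ` S) = vecs W \<longleftrightarrow> closed_lin V S = vecs V"
  using inj_on_image_eq_iff[OF inj V.closed_lin_subset, of "vecs V" S] assms
  by (simp add: closed_lin_image image)

text \<open>Boundedness carries a Cauchy sequence into \<open>W\<close>, surjectivity gives its
  limit a preimage, and the lower bound, through \<open>tendsto_iff\<close>, brings the convergence
  back.\<close>

lemma mcomplete:
  assumes "Metric_space.mcomplete (vecs W) (vdist W)"
  shows "Metric_space.mcomplete (vecs V) (vdist V)"
  unfolding V.metric.mcomplete_def
proof (intro allI impI)
  fix \<sigma> assume \<sigma>: "V.metric.MCauchy \<sigma>"
  then have \<sigma>V: "\<sigma> n \<in> vecs V" for n by (auto simp: V.metric.MCauchy_def)
  have "W.metric.MCauchy (\<lambda>n. f (\<sigma> n))"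
    unfolding W.metric.MCauchy_def
  proof (intro conjI allI impI)
    show "range (\<lambda>n. f (\<sigma> n)) \<subseteq> vecs W" using \<sigma>V map_vecs by auto
    fix e :: real assume e: "e > 0"
    then have "e / (\<bar>K\<bar> + 1) > 0" by simp
    then obtain N where N: "\<And>n m. N \<le> n \<Longrightarrow> N \<le> m \<Longrightarrow> vdist V (\<sigma> n) (\<sigma> m) < e / (\<bar>K\<bar> + 1)"
      using \<sigma> unfolding V.metric.MCauchy_def by meson
    have "vdist W (f (\<sigma> n)) (f (\<sigma> m)) < e" if "N \<le> n" "N \<le> m" for n m
    proof -
      have "vdist W (f (\<sigma> n)) (f (\<sigma> m)) \<le> \<bar>K\<bar> * vnorm V (\<sigma> n - \<sigma> m)"
        using \<sigma>V upper_abs[of "\<sigma> n - \<sigma> m"] by (simp add: vdist_def map_vecs map_diff V.vecs_diff)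
      also have "\<dots> \<le> (\<bar>K\<bar> + 1) * vnorm V (\<sigma> n - \<sigma> m)"
        using \<sigma>V V.vnorm_nonneg[of "\<sigma> n - \<sigma> m"] by (simp add: algebra_simps V.vecs_diff)
      also have "\<dots> < e"
        using N[OF that] \<sigma>V by (simp add: vdist_def pos_less_divide_eq mult.commute)
      finally show ?thesis .
    qed
    then show "\<exists>N. \<forall>n n'. N \<le> n \<longrightarrow> N \<le> n' \<longrightarrow> vdist W (f (\<sigma> n)) (f (\<sigma> n')) < e" by blast
  qed
  then obtain y where y: "limitin W.metric.mtopology (\<lambda>n. f (\<sigma> n)) y sequentially"
    using assms unfolding W.metric.mcomplete_def by blast
  then have "y \<in> vecs W" by (rule W.metric.limitin_mspace)
  then obtain x where "x \<in> vecs V" "y = f x" using image by auto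
  then show "\<exists>x. limitin V.metric.mtopology \<sigma> x sequentially"
    using y tendsto_iff[of x \<sigma> sequentially] \<sigma>V unfolding vtop_def by auto
qed

end

section \<open>The space of square-summable sequences\<close>

lemma ell2_simps [simp]:
  "c \<in> vecs ell2 \<longleftrightarrow> summable (\<lambda>n. (cmod (c n))\<^sup>2)"
  "scl ell2 = (\<lambda>a c n. a * c n)"
  "cip ell2 c d = (\<Sum>n. c n * cnj (d n))"
  by (simp_all add: ell2_def)

lemma cmod_add_squared_le: "(cmod (x + y))\<^sup>2 \<le> 2 * (cmod x)\<^sup>2 + 2 * (cmod y)\<^sup>2"
proof -
  have "(cmod (x + y))\<^sup>2 \<le> (cmod x + cmod y)\<^sup>2"
    by (intro power_mono norm_triangle_ineq norm_ge_zero)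
  also have "\<dots> \<le> 2 * (cmod x)\<^sup>2 + 2 * (cmod y)\<^sup>2"
    using sum_squares_bound[of "cmod x" "cmod y"] by (simp add: power2_sum)
  finally show ?thesis .
qed

lemma vector_space_seq: "vector_space (\<lambda>(a::complex) c (n::nat). a * c n)"
  by standard (auto simp: fun_eq_iff algebra_simps)

interpretation seq: vector_space "\<lambda>(a::complex) c (n::nat). a * c n"
  by (rule vector_space_seq)

lemma summable_ell2_prod:
  assumes "summable (\<lambda>n. (cmod (c n))\<^sup>2)" "summable (\<lambda>n. (cmod (d n))\<^sup>2)"
  shows "summable (\<lambda>n. c n * cnj (d n))"
proof (rule summable_comparison_test')
  show "summable (\<lambda>n. (cmod (c n))\<^sup>2 + (cmod (d n))\<^sup>2)" using assms by (rule summable_add)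
  show "norm (c n * cnj (d n)) \<le> (cmod (c n))\<^sup>2 + (cmod (d n))\<^sup>2" for n
    using sum_squares_bound[of "cmod (c n)" "cmod (d n)"] mult_nonneg_nonneg[OF norm_ge_zero norm_ge_zero, of "c n" "d n"]
    unfolding norm_mult complex_mod_cnj by linarith
qed

interpretation ell2: complex_inner_space ell2
proof -
  interpret vector_space "scl ell2" using vector_space_seq by simp
  show "complex_inner_space ell2"
  proof
    show "subspace (vecs ell2)"
    proof (rule subspaceI)
      fix c d assume "c \<in> vecs ell2" "d \<in> vecs ell2"
      then have "summable (\<lambda>n. 2 * (cmod (c n))\<^sup>2 + 2 * (cmod (d n))\<^sup>2)"
        by (simp add: summable_add summable_mult)
      then have "summable (\<lambda>n. (cmod (c n + d n))\<^sup>2)"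
        by (rule summable_comparison_test') (simp add: cmod_add_squared_le)
      then show "c + d \<in> vecs ell2" by simp
    qed (simp_all add: norm_mult power_mult_distrib summable_mult)
  next
    fix c d :: "nat \<Rightarrow> complex" assume cd: "c \<in> vecs ell2" "d \<in> vecs ell2"
    then have "(\<lambda>n. c n * cnj (d n)) sums cip ell2 c d"
      by (simp add: summable_ell2_prod summable_sums)
    then have "(\<lambda>n. d n * cnj (c n)) sums cnj (cip ell2 c d)"
      by (subst (asm) sums_cnj[symmetric]) (simp add: mult.commute)
    then show "cip ell2 d c = cnj (cip ell2 c d)"
      by (simp add: sums_iff)
    fix a
    show "cip ell2 (scl ell2 a c) d = a * cip ell2 c d"
      using cd by (simp add: mult.assoc suminf_mult summable_ell2_prod)
  next
    fix c d g :: "nat \<Rightarrow> complex" assume "c \<in> vecs ell2" "d \<in> vecs ell2" "g \<in> vecs ell2"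
    then show "cip ell2 (c + d) g = cip ell2 c g + cip ell2 d g"
      by (simp add: ring_distribs suminf_add summable_ell2_prod)
  next
    fix c :: "nat \<Rightarrow> complex" assume c: "c \<in> vecs ell2" "c \<noteq> 0"
    then obtain i where "c i \<noteq> 0" by (auto simp: fun_eq_iff)
    then have "(\<Sum>n. (cmod (c n))\<^sup>2) > 0"
      using c by (intro suminf_pos2[of _ i]) auto
    moreover have "cip ell2 c c = of_real (\<Sum>n. (cmod (c n))\<^sup>2)"
      using c by (simp add: suminf_of_real complex_norm_square del: of_real_power)
    ultimately show "Re (cip ell2 c c) > 0" by simp
  qed
qed

lemma vnorm_ell2_squared:
  assumes "c \<in> vecs ell2"
  shows "(vnorm ell2 c)\<^sup>2 = (\<Sum>n. (cmod (c n))\<^sup>2)"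
proof -
  have "cip ell2 c c = of_real (\<Sum>n. (cmod (c n))\<^sup>2)"
    using assms by (simp add: suminf_of_real complex_norm_square del: of_real_power)
  then show ?thesis using assms by (simp only: ell2.vnorm_squared Re_complex_of_real)
qed

lemma cmod_le_vnorm_ell2:
  assumes "c \<in> vecs ell2"
  shows "cmod (c n) \<le> vnorm ell2 c"
proof (rule power2_le_imp_le)
  show "(cmod (c n))\<^sup>2 \<le> (vnorm ell2 c)\<^sup>2"
    using sum_le_suminf[of "\<lambda>n. (cmod (c n))\<^sup>2" "{n}"] assms by (simp add: vnorm_ell2_squared)
qed (use assms in \<open>rule ell2.vnorm_nonneg\<close>)

lemma finite_support_ell2:
  assumes "\<And>n. n \<ge> N \<Longrightarrow> c n = 0"
  shows "c \<in> vecs ell2" and "(vnorm ell2 c)\<^sup>2 = (\<Sum>n<N. (cmod (c n))\<^sup>2)"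
proof -
  have "(\<lambda>n. (cmod (c n))\<^sup>2) sums (\<Sum>n<N. (cmod (c n))\<^sup>2)"
    by (rule sums_finite) (use assms in auto)
  then show "c \<in> vecs ell2" "(vnorm ell2 c)\<^sup>2 = (\<Sum>n<N. (cmod (c n))\<^sup>2)"
    using vnorm_ell2_squared[of c] by (auto simp: sums_iff)
qed

text \<open>Under the identification with formal series this is the basis vector
  \<open>e m\<close>.\<close>

definition unit_seq :: "nat \<Rightarrow> nat \<Rightarrow> complex" where
  "unit_seq m n = (if n = m then 1 else 0)"

lemma unit_seq_ell2: "unit_seq m \<in> vecs ell2"
  by (rule finite_support_ell2[of "Suc m"]) (simp add: unit_seq_def)

lemma sum_unit_seq_apply: "(\<Sum>n<N. scl ell2 (c n) (unit_seq n)) i = (if i < N then c i else 0)"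
proof (induction N)
  case (Suc N)
  then show ?case by (simp add: unit_seq_def less_Suc_eq del: ell2_simps) (simp add: unit_seq_def)
qed simp

lemma sum_unit_seq:
  assumes "\<And>n. n \<ge> N \<Longrightarrow> c n = 0"
  shows "(\<Sum>n<N. scl ell2 (c n) (unit_seq n)) = c"
  unfolding fun_eq_iff sum_unit_seq_apply using assms by (simp add: not_less)

text \<open>The index set \<open>A\<close> admits spans with one vector left out, as they occur in
  the definition of minimality.\<close>

lemma finite_support_in_lin:
  assumes "\<And>n. n \<ge> N \<Longrightarrow> c n = 0" "\<And>n. c n \<noteq> 0 \<Longrightarrow> n \<in> A"
  shows "c \<in> lin ell2 (unit_seq ` A)"
proof -
  have "(\<Sum>n<N. scl ell2 (c n) (unit_seq n)) \<in> lin ell2 (unit_seq ` A)"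
    unfolding lin_def
  proof (rule ell2.span_sum)
    fix n
    show "scl ell2 (c n) (unit_seq n) \<in> ell2.span (unit_seq ` A)"
    proof (cases "c n = 0")
      case True
      then have "scl ell2 (c n) (unit_seq n) = 0" by (simp add: fun_eq_iff)
      then show ?thesis using ell2.span_zero by metis
    next
      case False
      then show ?thesis using assms(2) by (intro ell2.span_scale ell2.span_base) auto
    qed
  qed
  then show ?thesis by (simp only: sum_unit_seq[OF assms(1)])
qed

lemma limitin_ell2_imp_tendsto:
  assumes "limitin (vtop ell2) g c F"
  shows "((\<lambda>i. g i n) \<longlongrightarrow> c n) F"
proof -
  have g: "c \<in> vecs ell2" "\<forall>\<^sub>F i in F. g i \<in> vecs ell2" "((\<lambda>i. vnorm ell2 (g i - c)) \<longlongrightarrow> 0) F"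
    using assms by (simp_all only: ell2.limitin_vtop_iff)
  have "\<forall>\<^sub>F i in F. cmod (g i n - c n) \<le> vnorm ell2 (g i - c)"
    using g(2)
  proof eventually_elim
    case (elim i)
    then show ?case using cmod_le_vnorm_ell2[OF ell2.vecs_diff[OF elim g(1)], of n] by simp
  qed
  then have "((\<lambda>i. g i n - c n) \<longlongrightarrow> 0) F"
    using g(3) by (rule Lim_null_comparison)
  then show ?thesis by (simp only: LIM_zero_iff)
qed

text \<open>Norm convergence implies convergence of each coordinate, and the coordinates of the
  partial sums are eventually constant; this identifies the limit. Conversely, the remainder is a
  tail of \<open>c\<close>, whose norm tends to 0.\<close>

lemma series_to_ell2_iff: "series_to ell2 unit_seq c v \<longleftrightarrow> c \<in> vecs ell2 \<and> v = c"
proof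
  assume L: "series_to ell2 unit_seq c v"
  have "v n = c n" for n
  proof (rule LIMSEQ_unique)
    show "(\<lambda>N. (\<Sum>n<N. scl ell2 (c n) (unit_seq n)) n) \<longlonglongrightarrow> v n"
      using limitin_ell2_imp_tendsto L unfolding series_to_def by blast
    show "(\<lambda>N. (\<Sum>n<N. scl ell2 (c n) (unit_seq n)) n) \<longlonglongrightarrow> c n"
      unfolding sum_unit_seq_apply
      by (rule tendsto_eventually, rule eventually_sequentiallyI[of "Suc n"]) simp
  qed
  then have "v = c" by auto
  moreover have "v \<in> vecs ell2"
    using L unfolding series_to_def ell2.limitin_vtop_iff by (rule conjunct1)
  ultimately show "c \<in> vecs ell2 \<and> v = c" by simp
next
  assume "c \<in> vecs ell2 \<and> v = c"
  then have c: "c \<in> vecs ell2" "v = c" by auto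
  let ?p = "\<lambda>N. \<Sum>n<N. scl ell2 (c n) (unit_seq n)"
  have p: "?p N \<in> vecs ell2" for N
    by (intro ell2.vecs_sum ell2.vecs_scl unit_seq_ell2)
  \<comment> \<open>The remainder vanishes below \<open>N\<close> and agrees with \<open>c\<close>
    up to sign from \<open>N\<close> on, so its squared norm is the tail of the series.\<close>
  have "(vnorm ell2 (?p N - c))\<^sup>2 = (\<Sum>n. (cmod (c n))\<^sup>2) - (\<Sum>n<N. (cmod (c n))\<^sup>2)" for N
  proof -
    have "(\<lambda>n. (cmod (c (n + N)))\<^sup>2) sums ((\<Sum>n. (cmod (c n))\<^sup>2) - (\<Sum>n<N. (cmod (c n))\<^sup>2))"
      using c by (intro sums_iff_shift'[THEN iffD2]) (simp add: summable_sums)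
    then have "(\<lambda>n. if n < N then 0 else (cmod (c n))\<^sup>2) sums ((\<Sum>n. (cmod (c n))\<^sup>2) - (\<Sum>n<N. (cmod (c n))\<^sup>2))"
      by (subst sums_iff_shift'[of _ N, symmetric]) simp
    moreover have "(\<lambda>n. (cmod ((?p N - c) n))\<^sup>2) = (\<lambda>n. if n < N then 0 else (cmod (c n))\<^sup>2)"
      by (auto simp: sum_unit_seq_apply[simplified] fun_eq_iff)
    ultimately have "(\<lambda>n. (cmod ((?p N - c) n))\<^sup>2) sums ((\<Sum>n. (cmod (c n))\<^sup>2) - (\<Sum>n<N. (cmod (c n))\<^sup>2))"
      by (simp only:)
    then show ?thesis
      using vnorm_ell2_squared[of "?p N - c"] p c ell2.vecs_diff by (simp only: sums_iff)
  qed
  moreover have "(\<lambda>N. (\<Sum>n. (cmod (c n))\<^sup>2) - (\<Sum>n<N. (cmod (c n))\<^sup>2)) \<longlonglongrightarrow> (\<Sum>n. (cmod (c n))\<^sup>2) - (\<Sum>n. (cmod (c n))\<^sup>2)"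
    using c by (intro tendsto_intros summable_LIMSEQ) simp
  ultimately have "(\<lambda>N. (vnorm ell2 (?p N - c))\<^sup>2) \<longlonglongrightarrow> 0" by simp
  then have "(\<lambda>N. sqrt ((vnorm ell2 (?p N - c))\<^sup>2)) \<longlonglongrightarrow> sqrt 0" by (rule tendsto_real_sqrt)
  then have "(\<lambda>N. vnorm ell2 (?p N - c)) \<longlonglongrightarrow> 0"
    using p c ell2.vnorm_nonneg[OF ell2.vecs_diff] by (simp only: real_sqrt_abs abs_of_nonneg real_sqrt_zero)
  then show "series_to ell2 unit_seq c v"
    unfolding series_to_def ell2.limitin_vtop_iff using p c by auto
qed

lemma closed_lin_unit_seq: "closed_lin ell2 (range unit_seq) = vecs ell2"
proof
  show "vecs ell2 \<subseteq> closed_lin ell2 (range unit_seq)"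
  proof
    fix c assume c: "c \<in> vecs ell2"
    then have "limitin (vtop ell2) (\<lambda>N. \<Sum>n<N. scl ell2 (c n) (unit_seq n)) c sequentially"
      using series_to_ell2_iff[of c c] by (simp only: series_to_def)
    then show "c \<in> closed_lin ell2 (range unit_seq)"
      unfolding closed_lin_def
    proof (rule limitin_closedin)
      have "(\<Sum>n<N. scl ell2 (c n) (unit_seq n)) \<in> lin ell2 (range unit_seq)" for N
        unfolding lin_def by (intro ell2.span_sum ell2.span_scale ell2.span_base) auto
      then show "\<forall>\<^sub>F N in sequentially. (\<Sum>n<N. scl ell2 (c n) (unit_seq n))
          \<in> vtop ell2 closure_of lin ell2 (range unit_seq)"
        using ell2.lin_subset_closed_lin[of "range unit_seq"] unit_seq_ell2
        unfolding closed_lin_def by (intro always_eventually) blast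
    qed auto
  qed
qed (rule ell2.closed_lin_subset)

section \<open>Orthonormal bases\<close>

locale hilbert_space_onb = complex_hilbert_space V for V :: "'a::ab_group_add cips" +
  fixes u :: "nat \<Rightarrow> 'a"
  assumes onb: "orthonormal_basis V u"
begin

lemma u_vecs: "u n \<in> vecs V"
  and u_cip: "cip V (u n) (u m) = (if n = m then 1 else 0)"
  and closed_lin_u: "closed_lin V (range u) = vecs V"
  using onb by (auto simp: orthonormal_basis_def)

lemma cip_partial_sum:
  "v \<in> vecs V \<Longrightarrow> cip V (\<Sum>n\<in>I. scl V (c n) (u n)) v = (\<Sum>n\<in>I. c n * cip V (u n) v)"
  by (simp add: cip_sum_left vecs_scl u_vecs cip_scl_left)

lemma cip_partial_sum_u:
  "finite I \<Longrightarrow> cip V (\<Sum>n\<in>I. scl V (c n) (u n)) (u m) = (if m \<in> I then c m else 0)"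
  by (simp add: cip_partial_sum u_vecs u_cip if_distrib cong: if_cong)

lemma partial_sum_vecs: "(\<Sum>n\<in>I. scl V (c n) (u n)) \<in> vecs V"
  by (intro vecs_sum vecs_scl u_vecs)

lemma vnorm_partial_sum:
  assumes "finite I"
  shows "(vnorm V (\<Sum>n\<in>I. scl V (c n) (u n)))\<^sup>2 = (\<Sum>n\<in>I. (cmod (c n))\<^sup>2)"
proof -
  let ?p = "\<Sum>n\<in>I. scl V (c n) (u n)"
  have "cip V (u n) ?p = cnj (c n)" if "n \<in> I" for n
    using cip_commute[of ?p "u n"] that assms by (simp add: partial_sum_vecs u_vecs cip_partial_sum_u)
  then have "cip V ?p ?p = (\<Sum>n\<in>I. c n * cnj (c n))"
    by (simp add: cip_partial_sum partial_sum_vecs)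
  also have "\<dots> = complex_of_real (\<Sum>n\<in>I. (cmod (c n))\<^sup>2)"
    by (simp add: complex_norm_square del: of_real_power)
  finally show ?thesis
    by (simp only: vnorm_squared partial_sum_vecs Re_complex_of_real)
qed

text \<open>Pythagoras for the projection onto finitely many \<open>u n\<close>. Nonnegativity of
  the left-hand side is Bessel's inequality; its limit is Parseval's identity.\<close>

lemma vnorm_minus_partial_sum:
  assumes "v \<in> vecs V" "finite I" and c: "\<And>n. n \<in> I \<Longrightarrow> c n = cip V v (u n)"
  shows "(vnorm V (v - (\<Sum>n\<in>I. scl V (c n) (u n))))\<^sup>2 = (vnorm V v)\<^sup>2 - (\<Sum>n\<in>I. (cmod (c n))\<^sup>2)"
proof -
  let ?p = "\<Sum>n\<in>I. scl V (c n) (u n)"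
  have "cip V ?p v = (\<Sum>n\<in>I. c n * cnj (c n))"
    using assms c cip_commute[of v "u _"] by (simp add: cip_partial_sum u_vecs)
  also have "\<dots> = complex_of_real (\<Sum>n\<in>I. (cmod (c n))\<^sup>2)"
    by (simp add: complex_norm_square del: of_real_power)
  finally have "Re (cip V v ?p) = (\<Sum>n\<in>I. (cmod (c n))\<^sup>2)"
    using cip_commute[of ?p v] assms partial_sum_vecs by simp
  then show ?thesis
    using assms by (simp add: vnorm_diff_squared partial_sum_vecs vnorm_partial_sum)
qed

lemma coeffs_ell2:
  assumes "v \<in> vecs V"
  shows "(\<lambda>n. cip V v (u n)) \<in> vecs ell2"
proof -
  have "summable (\<lambda>n. (cmod (cip V v (u n)))\<^sup>2)"
  proof (rule summableI_nonneg_bounded)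
    show "(\<Sum>n<N. (cmod (cip V v (u n)))\<^sup>2) \<le> (vnorm V v)\<^sup>2" for N
      using vnorm_minus_partial_sum[OF assms, of "{..<N}" "\<lambda>n. cip V v (u n)"]
        zero_le_power2[of "vnorm V (v - (\<Sum>n<N. scl V (cip V v (u n)) (u n)))"] by simp
  qed simp
  then show ?thesis by simp
qed

text \<open>By orthonormality the squared norm of a block of the series is a block of the convergent
  sum of squares, so the partial sums are Cauchy and completeness supplies \<open>v\<close>. Its
  coefficients are limits of those of the partial sums, which are eventually constant.\<close>

lemma Riesz_Fischer:
  assumes "c \<in> vecs ell2"
  obtains v where "v \<in> vecs V" "\<And>n. cip V v (u n) = c n"
    "limitin (vtop V) (\<lambda>N. \<Sum>n<N. scl V (c n) (u n)) v sequentially"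
proof -
  let ?p = "\<lambda>N. \<Sum>n<N. scl V (c n) (u n)"
  have dist: "vnorm V (?p n - ?p m) < e"
    if "(\<Sum>i\<in>{m..<n}. (cmod (c i))\<^sup>2) < e\<^sup>2" "m \<le> n" "e > 0" for m n e
  proof -
    have "?p n - ?p m = (\<Sum>i\<in>{m..<n}. scl V (c i) (u i))"
      using that(2) by (simp add: sum_diff_nat_ivl lessThan_atLeast0)
    then have "(vnorm V (?p n - ?p m))\<^sup>2 < e\<^sup>2"
      using that by (simp add: vnorm_partial_sum)
    then show ?thesis using power_less_imp_less_base[OF _ less_imp_le[OF that(3)]] by blast
  qed
  have "metric.MCauchy ?p"
    unfolding metric.MCauchy_def
  proof (intro conjI allI impI)
    show "range ?p \<subseteq> vecs V" using partial_sum_vecs by auto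
    fix e :: real assume e: "e > 0"
    then have "e\<^sup>2 > 0" by simp
    then obtain N where N: "\<And>m n. m \<ge> N \<Longrightarrow> norm (\<Sum>i\<in>{m..<n}. (cmod (c i))\<^sup>2) < e\<^sup>2"
      using assms unfolding ell2_simps summable_Cauchy by blast
    have le: "vdist V (?p n) (?p m) < e" if "N \<le> m" "m \<le> n" for m n
      using dist[of m n e] N[of m n] that e partial_sum_vecs by (simp add: vdist_def)
    have "vdist V (?p n) (?p m) < e" if "N \<le> n" "N \<le> m" for m n
      using le[of m n] le[of n m] that metric.commute[of "?p n" "?p m"] by linarith
    then show "\<exists>N. \<forall>n n'. N \<le> n \<longrightarrow> N \<le> n' \<longrightarrow> vdist V (?p n) (?p n') < e" by blast
  qed
  then obtain v where v: "limitin (vtop V) ?p v sequentially"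
    using complete unfolding metric.mcomplete_def vtop_def by blast
  then have vV: "v \<in> vecs V" and lim: "(\<lambda>N. vnorm V (?p N - v)) \<longlonglongrightarrow> 0"
    by (simp_all add: limitin_vtop_iff)
  have "cip V v (u n) = c n" for n
  proof -
    have "(\<lambda>N. cip V (?p N) (u n) - cip V v (u n)) \<longlonglongrightarrow> 0"
    proof (rule Lim_null_comparison[OF always_eventually lim], rule allI)
      fix N
      have "vnorm V (u n) = 1" by (simp add: vnorm_def u_cip)
      then show "norm (cip V (?p N) (u n) - cip V v (u n)) \<le> vnorm V (?p N - v)"
        using Cauchy_Schwarz[of "?p N - v" "u n"] vV partial_sum_vecs u_vecs
        by (simp add: vecs_diff cip_diff_left)
    qed
    then have "(\<lambda>N. cip V (?p N) (u n)) \<longlonglongrightarrow> cip V v (u n)"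
      by (simp only: LIM_zero_iff)
    moreover have "(\<lambda>N. cip V (?p N) (u n)) \<longlonglongrightarrow> c n"
      by (rule tendsto_eventually, rule eventually_sequentiallyI[of "Suc n"]) (simp add: cip_partial_sum_u)
    ultimately show ?thesis by (rule LIMSEQ_unique)
  qed
  then show thesis using v vV that by blast
qed

lemma eq_0_of_coeffs: "v \<in> vecs V \<Longrightarrow> (\<And>n. cip V v (u n) = 0) \<Longrightarrow> v = 0"
  using eq_0_of_orthogonal[of "range u" v] cip_commute[of v "u _"] u_vecs closed_lin_u by auto

text \<open>The Riesz-Fischer sum of the coefficients of \<open>v\<close> has the same coefficients
  as \<open>v\<close> and hence equals \<open>v\<close>. The remainders therefore tend to 0, and the
  Pythagoras formula passes to the limit.\<close>

lemma Parseval: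
  assumes "v \<in> vecs V"
  shows "vnorm ell2 (\<lambda>n. cip V v (u n)) = vnorm V v"
proof -
  let ?c = "\<lambda>n. cip V v (u n)"
  obtain w where w: "w \<in> vecs V" "\<And>n. cip V w (u n) = ?c n"
    "limitin (vtop V) (\<lambda>N. \<Sum>n<N. scl V (?c n) (u n)) w sequentially"
    using Riesz_Fischer[OF coeffs_ell2[OF assms]] by blast
  have "w - v = 0"
    using assms w by (intro eq_0_of_coeffs) (auto simp: vecs_diff cip_diff_left u_vecs)
  then have "(\<lambda>N. vnorm V ((\<Sum>n<N. scl V (?c n) (u n)) - v)) \<longlonglongrightarrow> 0"
    using w(3) by (simp add: limitin_vtop_iff)
  then have "(\<lambda>N. (vnorm V (v - (\<Sum>n<N. scl V (?c n) (u n))))\<^sup>2) \<longlonglongrightarrow> 0\<^sup>2"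
    using assms partial_sum_vecs vnorm_minus_commute by (intro tendsto_power) simp
  then have "(\<lambda>N. (vnorm V v)\<^sup>2 - (\<Sum>n<N. (cmod (?c n))\<^sup>2)) \<longlonglongrightarrow> 0"
    using assms by (simp add: vnorm_minus_partial_sum)
  moreover have "(\<lambda>N. (vnorm V v)\<^sup>2 - (\<Sum>n<N. (cmod (?c n))\<^sup>2)) \<longlonglongrightarrow> (vnorm V v)\<^sup>2 - (\<Sum>n. (cmod (?c n))\<^sup>2)"
    using coeffs_ell2[OF assms] by (intro tendsto_intros summable_LIMSEQ) simp
  ultimately have "(vnorm V v)\<^sup>2 = (vnorm ell2 ?c)\<^sup>2"
    using LIMSEQ_unique coeffs_ell2[OF assms] by (fastforce simp: vnorm_ell2_squared)
  then show ?thesis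
    using assms vnorm_nonneg ell2.vnorm_nonneg coeffs_ell2 by (metis power2_eq_imp_eq)
qed

lemma coeffs_isomorphism: "bounded_isomorphism V ell2 (\<lambda>v n. cip V v (u n)) 1 1"
proof
  show "linear_map V ell2 (\<lambda>v n. cip V v (u n))"
    using coeffs_ell2 by (auto simp: linear_map_def cip_add_left cip_scl_left u_vecs fun_eq_iff)
  show "(\<lambda>v n. cip V v (u n)) ` vecs V = vecs ell2"
  proof
    show "vecs ell2 \<subseteq> (\<lambda>v n. cip V v (u n)) ` vecs V"
    proof
      fix c assume "c \<in> vecs ell2"
      then obtain v where "v \<in> vecs V" "\<And>n. cip V v (u n) = c n" by (rule Riesz_Fischer) blast
      then show "c \<in> (\<lambda>v n. cip V v (u n)) ` vecs V" by (intro image_eqI[of _ _ v]) auto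
    qed
  qed (use coeffs_ell2 in blast)
qed (simp_all add: Parseval)

text \<open>The orthonormal basis dictates the coefficients of the representing vector. Testing the
  functional on the partial sums with these coefficients bounds their squared norms by the square of
  \<open>K\<close>, so the vector exists; agreement on the basis extends by density.\<close>

lemma Riesz_representation:
  assumes add: "\<And>x y. x \<in> vecs V \<Longrightarrow> y \<in> vecs V \<Longrightarrow> \<phi> (x + y) = \<phi> x + \<phi> y"
    and scl: "\<And>a x. x \<in> vecs V \<Longrightarrow> \<phi> (scl V a x) = a * \<phi> x"
    and bound: "\<And>x. x \<in> vecs V \<Longrightarrow> cmod (\<phi> x) \<le> K * vnorm V x"
  obtains z where "z \<in> vecs V" "\<And>x. x \<in> vecs V \<Longrightarrow> \<phi> x = cip V x z"
proof -
  define c where "c n = cnj (\<phi> (u n))" for n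
  have \<phi>_0: "\<phi> 0 = 0" using scl[of 0 0] vecs_zero by simp
  have \<phi>_sum: "\<phi> (\<Sum>n<N. scl V (c n) (u n)) = (\<Sum>n<N. c n * \<phi> (u n))" for N
    by (induction N) (simp_all add: \<phi>_0 add scl partial_sum_vecs vecs_scl u_vecs)
  have "(\<Sum>n<N. (cmod (c n))\<^sup>2) \<le> K\<^sup>2" for N
  proof -
    let ?p = "\<Sum>n<N. scl V (c n) (u n)"
    define s where "s = vnorm V ?p"
    have s: "s \<ge> 0" "s\<^sup>2 = (\<Sum>n<N. (cmod (c n))\<^sup>2)"
      by (simp_all add: s_def vnorm_nonneg partial_sum_vecs vnorm_partial_sum)
    have "\<phi> ?p = (\<Sum>n<N. c n * cnj (c n))" by (simp add: \<phi>_sum) (simp add: c_def)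
    also have "\<dots> = complex_of_real (s\<^sup>2)"
      by (simp add: s complex_norm_square del: of_real_power)
    finally have "s\<^sup>2 \<le> K * s"
      using bound[of ?p] by (simp add: partial_sum_vecs s_def norm_power)
    then have "s \<le> \<bar>K\<bar>"
      using s(1) by (cases "s = 0") (auto simp: power2_eq_square)
    then show ?thesis using s power_mono[of s "\<bar>K\<bar>" 2] by simp
  qed
  then have "c \<in> vecs ell2"
    by (auto intro!: summableI_nonneg_bounded)
  then obtain z where z: "z \<in> vecs V" "\<And>n. cip V z (u n) = c n" by (rule Riesz_Fischer) blast
  have "\<phi> x - cip V x z = 0" if "x \<in> vecs V" for x
  proof (rule bounded_functional_vanish[where \<phi> = "\<lambda>x. \<phi> x - cip V x z" and S = "range u" and K = "K + vnorm V z"])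
    fix y assume y: "y \<in> vecs V"
    have "cmod (\<phi> y - cip V y z) \<le> cmod (\<phi> y) + cmod (cip V y z)" by (rule norm_triangle_ineq4)
    also have "\<dots> \<le> K * vnorm V y + vnorm V y * vnorm V z"
      using bound[OF y] Cauchy_Schwarz[OF y z(1)] by simp
    finally show "cmod (\<phi> y - cip V y z) \<le> (K + vnorm V z) * vnorm V y" by (simp add: algebra_simps)
  next
    fix y assume "y \<in> range u"
    then obtain n where "y = u n" by auto
    then show "\<phi> y - cip V y z = 0"
      using z cip_commute[of z "u n"] by (simp add: u_vecs c_def)
  qed (use z that closed_lin_u u_vecs in \<open>auto simp: add scl cip_add_left cip_scl_left algebra_simps\<close>)
  then show thesis using z that by auto
qed

text \<open>The adjoint is a definite description, so uniqueness is needed besides the representing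
  vector: the difference of two candidates is orthogonal to itself.\<close>

lemma hilbert_adjoint:
  assumes "bounded_op V V A" "y \<in> vecs V"
  shows "hilbert_adjoint V A y \<in> vecs V"
    and "x \<in> vecs V \<Longrightarrow> cip V (A x) y = cip V x (hilbert_adjoint V A y)"
proof -
  have A: "A x \<in> vecs V" "A (x + x') = A x + A x'" "A (scl V a x) = scl V a (A x)"
    if "x \<in> vecs V" "x' \<in> vecs V" for x x' a
    using assms that by (auto simp: bounded_op_def linear_map_def)
  obtain K where K: "\<And>x. x \<in> vecs V \<Longrightarrow> vnorm V (A x) \<le> K * vnorm V x"
    using assms by (auto simp: bounded_op_def)
  have bound: "cmod (cip V (A x) y) \<le> (K * vnorm V y) * vnorm V x" if "x \<in> vecs V" for x
  proof -
    have "cmod (cip V (A x) y) \<le> vnorm V (A x) * vnorm V y"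
      using that A assms by (intro Cauchy_Schwarz) auto
    also have "\<dots> \<le> (K * vnorm V x) * vnorm V y"
      using that K assms by (intro mult_right_mono vnorm_nonneg) auto
    finally show ?thesis by (simp add: algebra_simps)
  qed
  obtain z where z: "z \<in> vecs V" "\<And>x. x \<in> vecs V \<Longrightarrow> cip V (A x) y = cip V x z"
    using Riesz_representation[of "\<lambda>x. cip V (A x) y" "K * vnorm V y"] A bound assms
    by (auto simp: cip_add_left cip_scl_left)
  have "hilbert_adjoint V A y = z"
    unfolding hilbert_adjoint_def
  proof (rule the_equality)
    fix z' assume z': "z' \<in> vecs V \<and> (\<forall>x\<in>vecs V. cip V (A x) y = cip V x z')"
    then have "cip V (z' - z) z' = cip V (z' - z) z"
      using z(1) z(2)[of "z' - z"] vecs_diff[of z' z] by auto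
    then have "cip V (z' - z) (z' - z) = 0"
      using z(1) z' by (simp add: cip_diff_right vecs_diff)
    then show "z' = z" using cip_pos[of "z' - z"] z(1) z' by (cases "z' = z") (auto simp: vecs_diff)
  qed (use z in blast)
  then show "hilbert_adjoint V A y \<in> vecs V"
    "x \<in> vecs V \<Longrightarrow> cip V (A x) y = cip V x (hilbert_adjoint V A y)"
    using z by auto
qed

end

section \<open>Backward differences and partial sums\<close>

definition psum :: "(nat \<Rightarrow> complex) \<Rightarrow> nat \<Rightarrow> complex" where
  "psum c n = (\<Sum>i\<le>n. c i)"

lemma bdiff_0 [simp]: "bdiff 0 c = c"
  by (simp add: bdiff_def fun_eq_iff)

lemma bdiff_1: "bdiff (Suc 0) c n = c n - (if n = 0 then 0 else c (n - 1))"
  by (simp add: bdiff_def)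

text \<open>Pascal's rule for the signed binomial coefficients, applied after separating the
  coefficients \<open>a\<close> from the shifted sequences \<open>s\<close>.\<close>

lemma bdiff_Suc: "bdiff (Suc k) c = bdiff (Suc 0) (bdiff k c)"
proof
  fix n
  define s where "s j n = (if j \<le> n then c (n - j) else 0)" for j n
  define a :: "nat \<Rightarrow> nat \<Rightarrow> complex" where "a k j = (- 1) ^ j * of_nat (k choose j)" for k j
  have bdiff: "bdiff k c n = (\<Sum>j\<le>k. a k j * s j n)" for k n
    by (simp add: bdiff_def a_def s_def)
  have a_Suc: "a (Suc k) (Suc j) = a k (Suc j) - a k j" for j
    by (simp add: a_def algebra_simps)
  \<comment> \<open>This zero coefficient allows the sum for order \<open>k\<close> to run up to
    \<open>Suc k\<close>, the range in which its index can be shifted.\<close>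
  have a_top: "a k (Suc k) = 0" by (simp add: a_def)
  \<comment> \<open>Shifting once more puts a 0 in front; the case \<open>n = 0\<close> has to be
    separate because natural subtraction would yield \<open>s j 0\<close> there.\<close>
  have s_Suc: "s (Suc j) n = (if n = 0 then 0 else s j (n - 1))" for j
    by (auto simp: s_def)
  have "bdiff (Suc k) c n = a (Suc k) 0 * s 0 n + (\<Sum>j\<le>k. a (Suc k) (Suc j) * s (Suc j) n)"
    unfolding bdiff by (rule sum.atMost_Suc_shift)
  also have "\<dots> = (a k 0 * s 0 n + (\<Sum>j\<le>k. a k (Suc j) * s (Suc j) n)) - (\<Sum>j\<le>k. a k j * s (Suc j) n)"
    by (simp add: a_Suc sum_subtractf left_diff_distrib) (simp add: a_def)
  also have "a k 0 * s 0 n + (\<Sum>j\<le>k. a k (Suc j) * s (Suc j) n) = (\<Sum>j\<le>Suc k. a k j * s j n)"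
    by (rule sum.atMost_Suc_shift[symmetric])
  also have "\<dots> = bdiff k c n"
    by (simp add: bdiff a_top)
  also have "(\<Sum>j\<le>k. a k j * s (Suc j) n) = (if n = 0 then 0 else bdiff k c (n - 1))"
    by (simp add: s_Suc bdiff)
  finally show "bdiff (Suc k) c n = bdiff (Suc 0) (bdiff k c) n"
    by (simp only: bdiff_1)
qed

text \<open>Powers of one operator commute. Taking one difference innermost is the useful form when
  the first difference of a sequence is known explicitly, as for the constant sequence and the
  tent.\<close>

lemma bdiff_Suc_right: "bdiff (Suc k) c = bdiff k (bdiff (Suc 0) c)"
proof (induction k)
  case (Suc k)
  show ?case
    by (subst bdiff_Suc) (simp only: Suc.IH bdiff_Suc[of k "bdiff (Suc 0) c"])
qed simp

lemma bdiff_add: "bdiff k (c + d) = bdiff k c + bdiff k d"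
  by (auto simp: bdiff_def fun_eq_iff sum.distrib[symmetric] algebra_simps intro!: sum.cong)

lemma bdiff_scl: "bdiff k (\<lambda>n. a * c n) = (\<lambda>n. a * bdiff k c n)"
  by (auto simp: bdiff_def fun_eq_iff sum_distrib_left algebra_simps intro!: sum.cong)

lemma bdiff_diff: "bdiff k (c - d) = bdiff k c - bdiff k d"
  using bdiff_add[of k "c - d" d] by (simp add: algebra_simps)

lemma bdiff_zero [simp]: "bdiff k 0 = 0"
  using bdiff_diff[of k 0 0] by simp

text \<open>Only the term \<open>j = 0\<close> meets an entry that may be nonzero. Differences of
  any order thus leave the leading entry intact, which later keeps a remainder away from 0.\<close>

lemma bdiff_first_nonzero:
  assumes "\<And>i. i < n \<Longrightarrow> c i = 0"
  shows "bdiff k c n = c n"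
proof -
  have "bdiff k c n = (\<Sum>j\<in>{0}. (- 1) ^ j * of_nat (k choose j) * (if j \<le> n then c (n - j) else 0))"
    unfolding bdiff_def by (rule sum.mono_neutral_right) (auto simp: assms)
  then show ?thesis by simp
qed

lemma bdiff_1_psum: "bdiff (Suc 0) (psum c) = c"
proof
  fix n show "bdiff (Suc 0) (psum c) n = c n"
    by (cases n) (simp_all add: bdiff_1 psum_def)
qed

lemma psum_bdiff_1: "psum (bdiff (Suc 0) c) = c"
proof
  fix n show "psum (bdiff (Suc 0) c) n = c n"
    by (induction n) (simp_all add: bdiff_1 psum_def)
qed

lemma bdiff_psum: "bdiff k ((psum ^^ k) c) = c"
proof (induction k)
  case (Suc k)
  then show ?case by (simp add: bdiff_Suc_right[of k] bdiff_1_psum)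
qed simp

lemma psum_bdiff: "(psum ^^ k) (bdiff k c) = c"
proof (induction k arbitrary: c)
  case (Suc k)
  then show ?case by (simp add: bdiff_Suc_right[of k] psum_bdiff_1)
qed simp

text \<open>Linearity is inherited from the inverse map \<open>bdiff k\<close>.\<close>

lemma psum_pow_add: "(psum ^^ k) (c + d) = (psum ^^ k) c + (psum ^^ k) d"
  using psum_bdiff[of k "(psum ^^ k) c + (psum ^^ k) d"] by (simp only: bdiff_add bdiff_psum)

lemma psum_pow_scl: "(psum ^^ k) (\<lambda>n. a * c n) = (\<lambda>n. a * (psum ^^ k) c n)"
  using psum_bdiff[of k "\<lambda>n. a * (psum ^^ k) c n"] by (simp only: bdiff_scl bdiff_psum)

text \<open>Summation leads out of \<open>ell2\<close>, but a fixed entry is a finite sum of entries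
  of the previous order. The constants add up over \<open>i \<le> n\<close>, so they are not uniform
  in \<open>n\<close>.\<close>

lemma psum_pow_bounded: "\<exists>C\<ge>0. \<forall>c\<in>vecs ell2. cmod ((psum ^^ k) c n) \<le> C * vnorm ell2 c"
proof (induction k arbitrary: n)
  case 0
  show ?case using cmod_le_vnorm_ell2 by (intro exI[of _ 1]) auto
next
  case (Suc k)
  then obtain C where C: "\<And>n. C n \<ge> 0" "\<And>n c. c \<in> vecs ell2 \<Longrightarrow> cmod ((psum ^^ k) c n) \<le> C n * vnorm ell2 c"
    by metis
  show ?case
  proof (intro exI conjI ballI)
    show "(\<Sum>i\<le>n. C i) \<ge> 0" by (simp add: C sum_nonneg)
    fix c assume "c \<in> vecs ell2"
    then show "cmod ((psum ^^ Suc k) c n) \<le> (\<Sum>i\<le>n. C i) * vnorm ell2 c"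
      using C(2) by (simp add: psum_def sum_distrib_right sum_norm_le del: ell2_simps)
  qed
qed

lemma tendsto_psum_pow:
  assumes "\<And>n. ((\<lambda>i. g i n) \<longlongrightarrow> c n) F"
  shows "((\<lambda>i. (psum ^^ k) (g i) n) \<longlongrightarrow> (psum ^^ k) c n) F"
  by (induction k arbitrary: n) (auto simp: psum_def intro!: assms tendsto_sum)

section \<open>The difference operator on square-summable sequences\<close>

text \<open>The first difference is the identity minus the right shift \<open>R\<close>, which is
  isometric; hence the constant 2.\<close>

interpretation bdiff_1: bounded_map ell2 ell2 "bdiff (Suc 0)" 2
proof
  define R where "R c n = (if n = 0 then 0 else c (n - 1))" for c :: "nat \<Rightarrow> complex" and n :: nat
  have R: "R c \<in> vecs ell2 \<and> vnorm ell2 (R c) = vnorm ell2 c" if c: "c \<in> vecs ell2" for c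
  proof -
    have "(\<lambda>n. (cmod (R c (Suc n)))\<^sup>2) sums (vnorm ell2 c)\<^sup>2"
      using c vnorm_ell2_squared[OF c] by (simp add: R_def sums_iff)
    then have "(\<lambda>n. (cmod (R c n))\<^sup>2) sums ((vnorm ell2 c)\<^sup>2 + (cmod (R c 0))\<^sup>2)"
      by (rule sums_Suc)
    then have "(\<lambda>n. (cmod (R c n))\<^sup>2) sums (vnorm ell2 c)\<^sup>2" by (simp add: R_def)
    then have "R c \<in> vecs ell2 \<and> (vnorm ell2 (R c))\<^sup>2 = (vnorm ell2 c)\<^sup>2"
      using vnorm_ell2_squared[of "R c"] by (simp add: sums_iff)
    then show ?thesis
      using ell2.vnorm_nonneg[of c] ell2.vnorm_nonneg[of "R c"] c by (metis power2_eq_iff_nonneg)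
  qed
  have bdiff: "bdiff (Suc 0) c = c - R c" for c
    by (simp add: fun_eq_iff bdiff_1 R_def)
  show "linear_map ell2 ell2 (bdiff (Suc 0))"
    unfolding linear_map_def
  proof (intro conjI ballI allI)
    show "bdiff (Suc 0) c \<in> vecs ell2" if "c \<in> vecs ell2" for c
      unfolding bdiff using that R ell2.vecs_diff by blast
  qed (simp_all add: bdiff_add bdiff_scl)
  show "vnorm ell2 (bdiff (Suc 0) c) \<le> 2 * vnorm ell2 c" if "c \<in> vecs ell2" for c
    unfolding bdiff using ell2.vnorm_triangle[of c "R c"] R[OF that] that by simp
qed

lemma bdiff_ell2: "c \<in> vecs ell2 \<Longrightarrow> bdiff k c \<in> vecs ell2"
proof (induction k)
  case (Suc k)
  then show ?case by (simp add: bdiff_Suc[of k] bdiff_1.map_vecs del: ell2_simps)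
qed simp

lemma vnorm_bdiff_le: "c \<in> vecs ell2 \<Longrightarrow> vnorm ell2 (bdiff k c) \<le> 2 ^ k * vnorm ell2 c"
proof (induction k)
  case (Suc k)
  then show ?case
    using bdiff_1.upper[OF bdiff_ell2[of c k]] by (simp add: bdiff_Suc[of k] del: ell2_simps)
qed simp

lemma bdiff_const_1: "bdiff (Suc 0) (\<lambda>n. 1) = unit_seq 0"
  by (simp add: fun_eq_iff bdiff_1 unit_seq_def)

text \<open>
  With the descending ramp of length \<open>N\<close> starting at \<open>m\<close>, only a block of \<open>N\<close> entries of
  size \<open>1 / N\<close> remains of the unit vector, and its norm is \<open>1 / sqrt N\<close>.
\<close>

lemma unit_seq_in_closed_lin_bdiff: "unit_seq m \<in> closed_lin ell2 (bdiff (Suc 0) ` range unit_seq)"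
proof -
  have sub: "range unit_seq \<subseteq> vecs ell2" using unit_seq_ell2 by auto
  have sub': "bdiff (Suc 0) ` range unit_seq \<subseteq> vecs ell2"
    using unit_seq_ell2 bdiff_1.map_vecs by auto
  show ?thesis
    unfolding ell2.closed_lin_iff[OF sub'] bdiff_1.lin_image[OF sub]
  proof (intro conjI allI impI unit_seq_ell2)
    fix r :: real assume r: "r > 0"
    obtain M :: nat where M: "1 / real (Suc M) < r\<^sup>2"
      using reals_Archimedean[of "r\<^sup>2"] r by (auto simp: inverse_eq_divide)
    define N where "N = Suc M"
    define p :: "nat \<Rightarrow> complex"
      where "p j = (if m \<le> j \<and> j < m + N then of_real (1 - real (j - m) / real N) else 0)" for j
    have p: "p \<in> lin ell2 (range unit_seq)"
      by (rule finite_support_in_lin[of "m + N"]) (auto simp: p_def)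
    define g where "g = unit_seq m - bdiff (Suc 0) p"
    have g: "g j = (if m < j \<and> j \<le> m + N then of_real (1 / real N) else 0)" for j
    proof -
      \<comment> \<open>At \<open>m\<close> the jump of the ramp from 0 to 1 cancels the unit
        vector. At \<open>m + N\<close> the ramp drops from \<open>1 / N\<close> to 0, so this index
        still belongs to the block.\<close>
      consider "j < m" | "j = m" | "m < j" "j < m + N" | "j = m + N" | "m + N < j" by linarith
      then show ?thesis
      proof cases
        case 3
        then have "real (j - m) = real (j - 1 - m) + 1" by linarith
        then have "real (j - m) / real N = real (j - 1 - m) / real N + 1 / real N"
          by (simp only: add_divide_distrib)
        moreover have "p j = of_real (1 - real (j - m) / real N)" "p (j - 1) = of_real (1 - real (j - 1 - m) / real N)"
          using 3 by (auto simp: p_def)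
        ultimately have "p (j - 1) - p j = of_real (1 / real N)" by simp
        then show ?thesis using 3 by (simp add: g_def bdiff_1 unit_seq_def)
      qed (auto simp: g_def bdiff_1 p_def unit_seq_def N_def field_simps)
    qed
    have "(vnorm ell2 g)\<^sup>2 = (\<Sum>j<m + N + 1. (cmod (g j))\<^sup>2)"
      by (rule finite_support_ell2) (simp add: g)
    also have "\<dots> = (\<Sum>j\<in>{m<..m + N}. (1 / real N)\<^sup>2)"
      by (rule sum.mono_neutral_cong_right) (auto simp: g norm_divide)
    also have "\<dots> = 1 / real N"
      by (simp add: power2_eq_square N_def)
    finally have "(vnorm ell2 g)\<^sup>2 < r\<^sup>2" using M by (simp add: N_def)
    then have "vnorm ell2 g < r"
      using power_less_imp_less_base[OF _ less_imp_le[OF r]] by blast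
    then show "\<exists>y\<in>bdiff (Suc 0) ` lin ell2 (range unit_seq). vnorm ell2 (unit_seq m - y) < r"
      using p unfolding g_def by blast
  qed
qed

text \<open>In the induction the unit vectors are approximated by their first differences. These lie
  in the image, under the bounded first difference, of a span that is dense by induction hypothesis,
  hence in the closed span of the differences of order \<open>Suc k\<close>.\<close>

lemma closed_lin_bdiff_unit_seq: "closed_lin ell2 (bdiff k ` range unit_seq) = vecs ell2"
proof (induction k)
  case 0
  show ?case using closed_lin_unit_seq by (simp del: ell2_simps)
next
  case (Suc k)
  have sub: "bdiff k ` range unit_seq \<subseteq> vecs ell2" for k
    using unit_seq_ell2 bdiff_ell2 by blast
  have "vecs ell2 = closed_lin ell2 (range unit_seq)"
    by (rule closed_lin_unit_seq[symmetric])
  also have "\<dots> \<subseteq> closed_lin ell2 (bdiff (Suc 0) ` range unit_seq)"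
    using unit_seq_in_closed_lin_bdiff by (intro ell2.closed_lin_minimal sub) blast
  also have "\<dots> \<subseteq> closed_lin ell2 (bdiff (Suc k) ` range unit_seq)"
  proof (intro ell2.closed_lin_minimal sub)
    have "bdiff (Suc 0) ` range unit_seq \<subseteq> bdiff (Suc 0) ` closed_lin ell2 (bdiff k ` range unit_seq)"
      unfolding Suc.IH using unit_seq_ell2 by blast
    also have "\<dots> \<subseteq> closed_lin ell2 (bdiff (Suc 0) ` bdiff k ` range unit_seq)"
      by (rule bdiff_1.closed_lin_image_subset[OF sub])
    also have "bdiff (Suc 0) ` bdiff k ` range unit_seq = bdiff (Suc k) ` range unit_seq"
      by (simp only: image_image bdiff_Suc[of k])
    finally show "bdiff (Suc 0) ` range unit_seq \<subseteq> closed_lin ell2 (bdiff (Suc k) ` range unit_seq)" .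
  qed
  finally show ?case by (rule subset_antisym[OF ell2.closed_lin_subset])
qed

text \<open>The witness is the tent of height 1 and base \<open>2n + 2\<close> around \<open>n\<close>.\<close>

lemma flat_bump:
  obtains p where "p n = 1" "\<And>j. j \<ge> 2 * n + 1 \<Longrightarrow> p j = 0"
    "(vnorm ell2 (bdiff (Suc 0) p))\<^sup>2 \<le> 2 / real (Suc n)"
proof -
  define h where "h = 1 / real (Suc n)"
  have h: "h > 0" "h * (1 + real n) = 1" by (auto simp: h_def divide_simps)
  define q where "q j = max 0 (1 - \<bar>real j - real n\<bar> * h)" for j
  define p where "p = (\<lambda>j. complex_of_real (q j))"
  have q0: "q j = 0" if "j \<ge> 2 * n + 1" for j
  proof -
    have "1 + real n \<le> \<bar>real j - real n\<bar>" using that by linarith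
    then have "1 \<le> \<bar>real j - real n\<bar> * h"
      using h mult_right_mono[of "1 + real n" "\<bar>real j - real n\<bar>" h] by (simp add: mult.commute)
    then show ?thesis by (simp add: q_def)
  qed
  \<comment> \<open>Before clipping, neighbouring values differ by at most \<open>h\<close>, and
    taking the maximum with 0 does not increase distances.\<close>
  have step: "\<bar>q (Suc j) - q j\<bar> \<le> h" for j
  proof -
    have "\<bar>real (Suc j) - real n\<bar> * h \<le> (\<bar>real j - real n\<bar> + 1) * h"
      "\<bar>real j - real n\<bar> * h \<le> (\<bar>real (Suc j) - real n\<bar> + 1) * h"
      using h by (intro mult_right_mono; linarith)+
    then show ?thesis unfolding q_def distrib_right by linarith
  qed
  \<comment> \<open>The difference at index 0 is the entry itself, since the preceding entry counts
    as 0. The tent starts at \<open>h\<close>, so this entry obeys the same bound as the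
    increments.\<close>
  have "q 0 = h" using h by (simp add: q_def algebra_simps)
  then have bound: "cmod (bdiff (Suc 0) p j) \<le> h" for j
    using step h(1) by (cases j) (auto simp: bdiff_1 p_def simp flip: of_real_diff)
  have supp: "bdiff (Suc 0) p j = 0" if "j \<ge> 2 * n + 2" for j
    using that q0[of j] q0[of "j - 1"] by (simp add: bdiff_1 p_def)
  have "(vnorm ell2 (bdiff (Suc 0) p))\<^sup>2 = (\<Sum>j<2 * n + 2. (cmod (bdiff (Suc 0) p j))\<^sup>2)"
    using supp by (rule finite_support_ell2)
  also have "\<dots> \<le> (\<Sum>j<2 * n + 2. h\<^sup>2)"
    using bound by (intro sum_mono power_mono) auto
  also have "\<dots> = 2 * (h * (1 + real n)) * h"
    by (simp add: power2_eq_square algebra_simps)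
  also have "\<dots> = 2 / real (Suc n)"
    unfolding h(2) by (simp add: h_def)
  finally have "(vnorm ell2 (bdiff (Suc 0) p))\<^sup>2 \<le> 2 / real (Suc n)" .
  then show thesis
    using that[of p] q0 by (simp add: p_def q_def)
qed

section \<open>Coefficients with respect to a Riesz basis\<close>

text \<open>\<open>X\<close> is the coefficient map of the Riesz basis \<open>e\<close>. The
  orthonormal basis \<open>u\<close> is kept beside it for the Riesz representation in
  \<open>H\<close> and for the orthonormal basis of the space of formal series.\<close>

locale riesz_basis_coords =
  hilbert_space_onb H u + coords: bounded_isomorphism H ell2 X K L
  for H :: "'a::ab_group_add cips" and u X K L +
  fixes e :: "nat \<Rightarrow> 'a"
  assumes e_vecs: "e n \<in> vecs H"
    and X_e: "X (e n) = unit_seq n"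

text \<open>As \<open>e n = A (u n)\<close>, the coefficients of \<open>v\<close> along
  \<open>e\<close> are those of \<open>B v\<close> along \<open>u\<close>. The bounds of
  \<open>B\<close> and \<open>A\<close> become the upper and lower constants of
  \<open>X\<close>.\<close>

lemma riesz_basis_coords_exist:
  assumes "complex_hilbert_space H" "riesz_basis H e"
  obtains u X K L where "riesz_basis_coords H u X K L e"
proof -
  interpret complex_hilbert_space H by fact
  obtain u A B where u: "orthonormal_basis H u" and A: "bounded_op H H A" and B: "bounded_op H H B"
    and inv: "\<And>v. v \<in> vecs H \<Longrightarrow> B (A v) = v \<and> A (B v) = v" and e: "\<And>n. e n = A (u n)"
    using assms(2) by (auto simp: riesz_basis_def)
  interpret hilbert_space_onb H u by unfold_locales (rule u)
  interpret c: bounded_isomorphism H ell2 "\<lambda>v n. cip H v (u n)" 1 1 by (rule coeffs_isomorphism)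
  obtain KA KB where K: "\<And>x. x \<in> vecs H \<Longrightarrow> vnorm H (A x) \<le> KA * vnorm H x"
    "\<And>x. x \<in> vecs H \<Longrightarrow> vnorm H (B x) \<le> KB * vnorm H x"
    using A B by (auto simp: bounded_op_def)
  have AV: "A x \<in> vecs H" and BV: "B x \<in> vecs H" if "x \<in> vecs H" for x
    using A B that by (auto simp: bounded_op_def linear_map_def)
  define X where "X v = (\<lambda>n. cip H (B v) (u n))" for v
  have norm_X: "vnorm ell2 (X v) = vnorm H (B v)" if "v \<in> vecs H" for v
    unfolding X_def by (rule Parseval) (rule BV[OF that])
  have "riesz_basis_coords H u X KB KA e"
  proof (unfold_locales)
    have "linear_map H H B" using B by (simp add: bounded_op_def)
    then show "linear_map H ell2 X"
      unfolding linear_map_def X_def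
      using BV c.map_vecs c.map_add c.map_scl by (simp del: ell2_simps)
    show "vnorm ell2 (X x) \<le> KB * vnorm H x" if "x \<in> vecs H" for x
      using K(2) that norm_X by simp
    show "vnorm H x \<le> KA * vnorm ell2 (X x)" if "x \<in> vecs H" for x
      using K(1)[OF BV[OF that]] inv[OF that] norm_X[OF that] by simp
    show "X ` vecs H = vecs ell2"
    proof
      show "X ` vecs H \<subseteq> vecs ell2" unfolding X_def using BV c.map_vecs by blast
      show "vecs ell2 \<subseteq> X ` vecs H"
      proof
        fix d assume "d \<in> vecs ell2"
        then obtain v where v: "v \<in> vecs H" "d = (\<lambda>n. cip H v (u n))" using c.image by blast
        then have "d = X (A v)" using inv by (simp add: X_def)
        then show "d \<in> X ` vecs H" using AV v by blast
      qed
    qed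
    show "e n \<in> vecs H" for n using e AV u_vecs by simp
    show "X (e n) = unit_seq n" for n
      using e inv[OF u_vecs[of n]] by (auto simp: X_def u_cip unit_seq_def)
  qed
  then show thesis by (rule that)
qed

context riesz_basis_coords
begin

text \<open>The map \<open>X\<close> turns partial sums into truncations in \<open>ell2\<close>,
  where a sequence is its own expansion. Together with injectivity of \<open>X\<close> this settles
  the definite descriptions in \<open>coeff_seq\<close> and \<open>series_sum\<close>.\<close>

lemma series_to_iff: "series_to H e c v \<longleftrightarrow> v \<in> vecs H \<and> X v = c"
proof (cases "v \<in> vecs H")
  case True
  let ?p = "\<lambda>N. \<Sum>n<N. scl H (c n) (e n)"
  have p: "?p N \<in> vecs H" for N by (intro vecs_sum vecs_scl e_vecs)
  have "X (?p N) = (\<Sum>n<N. scl ell2 (c n) (unit_seq n))" for N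
    by (simp add: coords.map_sum vecs_scl e_vecs coords.map_scl X_e del: ell2_simps)
  then have "series_to H e c v \<longleftrightarrow> series_to ell2 unit_seq c (X v)"
    using coords.tendsto_iff[of v ?p sequentially] True p by (simp add: series_to_def del: ell2_simps)
  then show ?thesis
    using True coords.map_vecs[of v] by (auto simp: series_to_ell2_iff simp del: ell2_simps)
next
  case False
  then show ?thesis by (simp add: series_to_def limitin_vtop_iff)
qed

lemma coeff_seq_eq: "v \<in> vecs H \<Longrightarrow> coeff_seq H e v = X v"
  by (simp add: coeff_seq_def series_to_iff)

lemma coeff_seq_e: "coeff_seq H e (e n) = unit_seq n"
  by (simp add: coeff_seq_eq e_vecs X_e)

lemma series_sum:
  assumes "c \<in> vecs ell2"
  shows "series_sum H e c \<in> vecs H" "X (series_sum H e c) = c"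
proof -
  have "c \<in> X ` vecs H" using assms by (simp only: coords.image)
  then obtain v where v: "v \<in> vecs H" "X v = c" by blast
  then have "series_sum H e c = v"
    unfolding series_sum_def series_to_iff
    by (intro the_equality) (auto dest: inj_onD[OF coords.inj])
  then show "series_sum H e c \<in> vecs H" "X (series_sum H e c) = c" using v by auto
qed

lemma eq_of_X_eq: "v \<in> vecs H \<Longrightarrow> w \<in> vecs H \<Longrightarrow> X v = X w \<Longrightarrow> v = w"
  using coords.inj by (auto dest: inj_onD)

lemma closed_lin_e: "closed_lin H (range e) = vecs H"
proof -
  have "closed_lin ell2 (X ` range e) = vecs ell2"
    using closed_lin_unit_seq by (simp add: image_image X_e del: ell2_simps)
  then show ?thesis using coords.closed_lin_image_eq_iff[of "range e"] e_vecs by blast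
qed

lemma eq_of_cip_eq:
  assumes "y \<in> vecs H" "z \<in> vecs H" "\<And>x. x \<in> vecs H \<Longrightarrow> cip H x y = cip H x z"
  shows "y = z"
proof -
  have "cip H (y - z) (y - z) = 0"
    using assms(1,2) assms(3)[of "y - z"] by (simp add: cip_diff_right vecs_diff)
  then show ?thesis using cip_pos[of "y - z"] assms(1,2) by (cases "y = z") (auto simp: vecs_diff)
qed

section \<open>The spaces of formal series\<close>

lemma Hk_simps [simp]:
  "c \<in> vecs (Hk H e k) \<longleftrightarrow> bdiff k c \<in> vecs ell2"
  "scl (Hk H e k) = scl ell2"
  "cip (Hk H e k) c d = cip H (diff_op H e k c) (diff_op H e k d)"
  by (simp_all add: Hk_def)

declare ell2_simps [simp del]

lemma diff_op:
  assumes "bdiff k c \<in> vecs ell2"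
  shows "diff_op H e k c \<in> vecs H" "X (diff_op H e k c) = bdiff k c"
  using series_sum[OF assms] by (simp_all add: diff_op_def)

lemma bdiff_scl_ell2: "bdiff k (scl ell2 a c) = scl ell2 a (bdiff k c)"
  by (simp add: bdiff_scl ell2_simps)

lemma linear_diff_op: "linear_map (Hk H e k) H (diff_op H e k)"
  unfolding linear_map_def
proof (intro conjI ballI allI)
  fix c assume c: "c \<in> vecs (Hk H e k)"
  then show "diff_op H e k c \<in> vecs H" by (simp add: diff_op)
  fix a
  show "diff_op H e k (scl (Hk H e k) a c) = scl H a (diff_op H e k c)"
    using c by (intro eq_of_X_eq)
      (simp_all add: diff_op bdiff_scl_ell2 ell2.vecs_scl vecs_scl coords.map_scl)
  fix d assume d: "d \<in> vecs (Hk H e k)"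
  show "diff_op H e k (c + d) = diff_op H e k c + diff_op H e k d"
    using c d by (intro eq_of_X_eq)
      (simp_all add: diff_op bdiff_add ell2.vecs_add vecs_add coords.map_add)
qed

lemma complex_inner_space_Hk: "complex_inner_space (Hk H e k)"
proof -
  interpret W: vector_space "scl (Hk H e k)" using vector_space_seq by (simp add: ell2_simps)
  note lin = linear_diff_op[of k, unfolded linear_map_def]
  show ?thesis
  proof
    show "W.subspace (vecs (Hk H e k))"
      by (rule W.subspaceI) (simp_all add: bdiff_add bdiff_scl_ell2 ell2.vecs_add ell2.vecs_scl ell2.vecs_zero)
  next
    fix c d assume cd: "c \<in> vecs (Hk H e k)" "d \<in> vecs (Hk H e k)"
    then show "cip (Hk H e k) d c = cnj (cip (Hk H e k) c d)"
      using cip_commute[of "diff_op H e k c" "diff_op H e k d"] diff_op by simp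
    fix a
    show "cip (Hk H e k) (scl (Hk H e k) a c) d = a * cip (Hk H e k) c d"
      using cd lin cip_scl_left by simp
  next
    fix c d g assume cdg: "c \<in> vecs (Hk H e k)" "d \<in> vecs (Hk H e k)" "g \<in> vecs (Hk H e k)"
    then show "cip (Hk H e k) (c + d) g = cip (Hk H e k) c g + cip (Hk H e k) d g"
      using lin cip_add_left by simp
  next
    fix c assume c: "c \<in> vecs (Hk H e k)" "c \<noteq> 0"
    \<comment> \<open>Definiteness amounts to injectivity of the difference operator, and repeated
      summation recovers \<open>c\<close> from its differences.\<close>
    have "diff_op H e k c \<noteq> 0"
    proof
      assume "diff_op H e k c = 0"
      then have "bdiff k c = 0" using diff_op[of k c] c coords.map_zero by simp
      then show False using psum_bdiff[of k c] psum_bdiff[of k 0] c by simp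
    qed
    then show "Re (cip (Hk H e k) c c) > 0" using c cip_pos diff_op by simp
  qed
qed

text \<open>The norm on formal series is pulled back from \<open>H\<close>, so both constants are 1.
  Surjectivity holds because formal series need not converge: the repeated sums of any coefficient
  sequence are admissible, whatever their growth.\<close>

lemma diff_op_isomorphism: "bounded_isomorphism (Hk H e k) H (diff_op H e k) 1 1"
proof -
  interpret Hk: complex_inner_space "Hk H e k" by (rule complex_inner_space_Hk)
  show ?thesis
  proof
    show "linear_map (Hk H e k) H (diff_op H e k)" by (rule linear_diff_op)
    show "diff_op H e k ` vecs (Hk H e k) = vecs H"
    proof
      show "vecs H \<subseteq> diff_op H e k ` vecs (Hk H e k)"
      proof
        fix v assume v: "v \<in> vecs H"
        define c where "c = (psum ^^ k) (X v)"
        have c: "bdiff k c = X v" by (simp add: c_def bdiff_psum)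
        then have "v = diff_op H e k c"
          using v coords.map_vecs diff_op[of k c] by (intro eq_of_X_eq) simp_all
        then show "v \<in> diff_op H e k ` vecs (Hk H e k)"
          using c v coords.map_vecs by auto
      qed
    qed (use diff_op in auto)
  qed (simp_all add: vnorm_def)
qed

text \<open>On this space \<open>bdiff k\<close> is the isometry \<open>diff_op\<close> followed by
  \<open>X\<close>, hence the constants of \<open>X\<close>.\<close>

lemma bdiff_isomorphism: "bounded_isomorphism (Hk H e k) ell2 (bdiff k) K L"
proof -
  interpret D: bounded_isomorphism "Hk H e k" H "diff_op H e k" 1 1 by (rule diff_op_isomorphism)
  have norm: "vnorm (Hk H e k) c = vnorm H (diff_op H e k c)" for c
    by (simp add: vnorm_def)
  show ?thesis
  proof
    show "linear_map (Hk H e k) ell2 (bdiff k)"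
      by (simp add: linear_map_def bdiff_add bdiff_scl_ell2)
    have "c \<in> bdiff k ` vecs (Hk H e k)" if "c \<in> vecs ell2" for c
      using that bdiff_psum[of k c] by (intro image_eqI[of _ _ "(psum ^^ k) c"]) simp_all
    then show "bdiff k ` vecs (Hk H e k) = vecs ell2" by auto
    show "vnorm ell2 (bdiff k c) \<le> K * vnorm (Hk H e k) c" "vnorm (Hk H e k) c \<le> L * vnorm ell2 (bdiff k c)"
      if "c \<in> vecs (Hk H e k)" for c
      using that coords.upper[of "diff_op H e k c"] coords.lower[of "diff_op H e k c"]
      by (simp_all add: norm diff_op)
  qed
qed

end

section \<open>The space of formal series of a fixed order\<close>

locale formal_series_space = riesz_basis_coords H u X K L e
  for H :: "'a::ab_group_add cips" and u X K L e +
  fixes k :: nat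
begin

sublocale Hk: complex_inner_space "Hk H e k"
  by (rule complex_inner_space_Hk)

sublocale D: bounded_isomorphism "Hk H e k" H "diff_op H e k" 1 1
  by (rule diff_op_isomorphism)

sublocale bd: bounded_isomorphism "Hk H e k" ell2 "bdiff k" K L
  by (rule bdiff_isomorphism)

lemma complex_hilbert_space_Hk: "complex_hilbert_space (Hk H e k)"
  by unfold_locales (rule D.mcomplete[OF complete])

lemma unit_seq_Hk: "unit_seq n \<in> vecs (Hk H e k)"
  by (simp add: bdiff_ell2 unit_seq_ell2)

text \<open>Each difference at most doubles the norm 1 of a unit vector in \<open>ell2\<close>, and
  \<open>L\<close> compares the two norms. Independence of \<open>n\<close> is what uniform
  minimality of \<open>chi\<close> requires.\<close>

lemma vnorm_unit_seq_le: "vnorm (Hk H e k) (unit_seq n) \<le> \<bar>L\<bar> * 2 ^ k"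
proof -
  have "(vnorm ell2 (unit_seq n))\<^sup>2 = (\<Sum>j<Suc n. (cmod (unit_seq n j))\<^sup>2)"
    by (rule finite_support_ell2) (simp add: unit_seq_def)
  then have "vnorm ell2 (unit_seq n) = 1"
    using ell2.vnorm_nonneg[OF unit_seq_ell2, of n] by (auto simp: unit_seq_def power2_eq_1_iff)
  then have "vnorm ell2 (bdiff k (unit_seq n)) \<le> 2 ^ k"
    using vnorm_bdiff_le[OF unit_seq_ell2, of k n] by simp
  then have "\<bar>L\<bar> * vnorm ell2 (bdiff k (unit_seq n)) \<le> \<bar>L\<bar> * 2 ^ k"
    by (intro mult_left_mono) auto
  then show ?thesis using bd.lower_abs[OF unit_seq_Hk, of n] by linarith
qed

lemma closed_lin_unit_seq_Hk: "closed_lin (Hk H e k) (range unit_seq) = vecs (Hk H e k)"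
  using bd.closed_lin_image_eq_iff[of "range unit_seq"] closed_lin_bdiff_unit_seq unit_seq_Hk by blast

text \<open>The isometry pulls back the orthonormal basis \<open>u\<close>; a Riesz basis such as
  \<open>e\<close> would only give a Riesz basis.\<close>

lemma orthonormal_basis_Hk:
  "orthonormal_basis (Hk H e k) (\<lambda>n. inv_into (vecs (Hk H e k)) (diff_op H e k) (u n))"
proof -
  let ?w = "\<lambda>n. inv_into (vecs (Hk H e k)) (diff_op H e k) (u n)"
  have w: "?w n \<in> vecs (Hk H e k)" "diff_op H e k (?w n) = u n" for n
    using D.image u_vecs[of n] by (metis inv_into_into, metis f_inv_into_f)
  have "diff_op H e k ` range ?w = range u"
    by (simp add: image_image w(2))
  then have "closed_lin (Hk H e k) (range ?w) = vecs (Hk H e k)"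
    using D.closed_lin_image_eq_iff[of "range ?w"] closed_lin_u w(1) by (simp only:) blast
  then show ?thesis
    unfolding orthonormal_basis_def using w by (auto simp: u_cip simp del: Hk_simps(1))
qed

lemma const_1_Hk:
  assumes "k \<ge> 1"
  shows "(\<lambda>n. 1) \<in> vecs (Hk H e k)"
proof -
  obtain j where "k = Suc j" using assms by (cases k) auto
  then have "bdiff k (\<lambda>n. 1) = bdiff j (unit_seq 0)"
    by (simp add: bdiff_Suc_right[of j] bdiff_const_1)
  then show ?thesis by (simp add: bdiff_ell2 unit_seq_ell2)
qed

text \<open>Convergence in this space implies convergence of every coordinate, so the only possible
  coefficients of the constant sequence 1 are all 1. The resulting partial sums do not
  converge.\<close>

lemma not_schauder_basis_unit_seq:
  assumes "k \<ge> 1"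
  shows "\<not> schauder_basis (Hk H e k) unit_seq"
proof
  assume "schauder_basis (Hk H e k) unit_seq"
  then obtain c where c: "series_to (Hk H e k) unit_seq c (\<lambda>n. 1)"
    using const_1_Hk[OF assms] unfolding schauder_basis_def by blast
  define p where "p N = (\<Sum>n<N. scl ell2 (c n) (unit_seq n))" for N
  have p_Hk: "p N \<in> vecs (Hk H e k)" for N
    unfolding p_def using unit_seq_ell2
    by (simp add: bdiff_ell2 ell2.vecs_sum ell2.vecs_scl)
  have "limitin (vtop (Hk H e k)) p (\<lambda>n. 1) sequentially"
    using c by (simp add: series_to_def p_def[abs_def])
  then have lim: "limitin (vtop ell2) (\<lambda>N. bdiff k (p N)) (bdiff k (\<lambda>n. 1)) sequentially"
    using bd.tendsto_iff[of "\<lambda>n. 1" p sequentially] const_1_Hk[OF assms] p_Hk by blast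
  have "c n = 1" for n
  proof -
    have "(\<lambda>N. (psum ^^ k) (bdiff k (p N)) n) \<longlonglongrightarrow> (psum ^^ k) (bdiff k (\<lambda>n. 1)) n"
      by (rule tendsto_psum_pow) (rule limitin_ell2_imp_tendsto[OF lim])
    then have "(\<lambda>N. p N n) \<longlonglongrightarrow> 1" by (simp add: psum_bdiff)
    moreover have "(\<lambda>N. p N n) \<longlonglongrightarrow> c n"
      unfolding p_def sum_unit_seq_apply
      by (rule tendsto_eventually, rule eventually_sequentiallyI[of "Suc n"]) simp
    ultimately show ?thesis using LIMSEQ_unique by blast
  qed
  then have p: "p N i = (if i < N then 1 else 0)" for N i
    unfolding p_def sum_unit_seq_apply by simp
  have ge: "1 \<le> vnorm ell2 (bdiff k (p N) - bdiff k (\<lambda>n. 1))" for N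
  proof -
    have "bdiff k (p N) - bdiff k (\<lambda>n. 1) \<in> vecs ell2"
      using p_Hk const_1_Hk[OF assms] ell2.vecs_diff by simp
    then have "cmod ((bdiff k (p N) - bdiff k (\<lambda>n. 1)) N) \<le> vnorm ell2 (bdiff k (p N) - bdiff k (\<lambda>n. 1))"
      by (rule cmod_le_vnorm_ell2)
    \<comment> \<open>The remainder is 0 below \<open>N\<close> and -1 at \<open>N\<close>, and a
      leading entry survives the differences.\<close>
    moreover have "(bdiff k (p N) - bdiff k (\<lambda>n. 1)) N = -1"
      unfolding bdiff_diff[symmetric] by (subst bdiff_first_nonzero) (simp_all add: p)
    ultimately show ?thesis by simp
  qed
  have "(\<lambda>N. vnorm ell2 (bdiff k (p N) - bdiff k (\<lambda>n. 1))) \<longlonglongrightarrow> 0"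
    using lim unfolding ell2.limitin_vtop_iff by blast
  from LIMSEQ_le_const[OF this, of 1] have "(1::real) \<le> 0" using ge by blast
  then show False by simp
qed

lemma not_uniformly_minimal_unit_seq:
  assumes "k \<ge> 1"
  shows "\<not> uniformly_minimal_seq (Hk H e k) unit_seq"
proof
  assume "uniformly_minimal_seq (Hk H e k) unit_seq"
  then obtain r where r: "r > 0"
    "\<And>n. r \<le> dist_to_set (Hk H e k) (unit_seq n) (closed_lin (Hk H e k) (unit_seq ` {j. j \<noteq> n}))"
    by (rule Hk.uniformly_minimal_seqD) blast
  obtain j where k: "k = Suc j" using assms by (cases k) auto
  define M where "M = (\<bar>L\<bar> * 2 ^ j)\<^sup>2"
  have le: "r\<^sup>2 \<le> M * (2 / real (Suc n))" for n
  proof -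
    obtain p where p: "p n = 1" "\<And>j. j \<ge> 2 * n + 1 \<Longrightarrow> p j = 0"
      "(vnorm ell2 (bdiff (Suc 0) p))\<^sup>2 \<le> 2 / real (Suc n)" by (rule flat_bump[of n]) blast
    have p_ell2: "p \<in> vecs ell2" using p(2) by (rule finite_support_ell2)
    have sub: "unit_seq ` {j. j \<noteq> n} \<subseteq> vecs (Hk H e k)" using unit_seq_Hk by blast
    \<comment> \<open>As \<open>p n = 1\<close>, the entry at \<open>n\<close> cancels. Thus the
      norm of \<open>p\<close> is the distance from \<open>unit_seq n\<close> to one element of the
      span of the others.\<close>
    have "unit_seq n - p \<in> lin ell2 (unit_seq ` {j. j \<noteq> n})"
      by (rule finite_support_in_lin[of "2 * n + 1"]) (auto simp: p unit_seq_def split: if_splits)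
    then have "unit_seq n - p \<in> closed_lin (Hk H e k) (unit_seq ` {j. j \<noteq> n})"
      using Hk.lin_subset_closed_lin[OF sub] by (auto simp: lin_def)
    then have "r \<le> vnorm (Hk H e k) p"
      using Hk.dist_to_set_le[OF unit_seq_Hk[of n] sub, of "unit_seq n - p"] r(2)[of n] by simp
    also have "\<dots> \<le> \<bar>L\<bar> * vnorm ell2 (bdiff k p)"
      using p_ell2 by (intro bd.lower_abs) (simp add: bdiff_ell2)
    \<comment> \<open>One difference makes the tent small; the other \<open>j\<close> cost at most
      the fixed factor \<open>2 ^ j\<close>, absorbed in \<open>M\<close>.\<close>
    also have "\<dots> \<le> \<bar>L\<bar> * (2 ^ j * vnorm ell2 (bdiff (Suc 0) p))"
      unfolding k bdiff_Suc_right[of j] using p_ell2 by (intro mult_left_mono vnorm_bdiff_le bdiff_ell2) auto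
    finally have "r\<^sup>2 \<le> (\<bar>L\<bar> * 2 ^ j * vnorm ell2 (bdiff (Suc 0) p))\<^sup>2"
      using r(1) by (intro power_mono) (auto simp: mult.assoc)
    also have "\<dots> = M * (vnorm ell2 (bdiff (Suc 0) p))\<^sup>2"
      by (simp add: M_def power_mult_distrib)
    also have "\<dots> \<le> M * (2 / real (Suc n))"
      using p(3) by (intro mult_left_mono) (auto simp: M_def)
    finally show ?thesis .
  qed
  have "(\<lambda>n. M * (2 / real (Suc n))) \<longlonglongrightarrow> 0"
    by (rule tendsto_mult_right_zero, rule LIMSEQ_Suc, rule lim_const_over_n)
  from LIMSEQ_le_const[OF this, of "r\<^sup>2"] have "r\<^sup>2 \<le> 0" using le by blast
  then show False using r(1) by simp
qed

lemma null_sequences_subspace: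
  "Hk.subspace {c \<in> vecs (Hk H e k). c \<longlonglongrightarrow> 0}"
proof (rule Hk.subspaceI)
  show "0 \<in> {c \<in> vecs (Hk H e k). c \<longlonglongrightarrow> 0}"
    using Hk.vecs_zero by (simp add: zero_fun_def)
next
  fix c d assume "c \<in> {c \<in> vecs (Hk H e k). c \<longlonglongrightarrow> 0}" "d \<in> {c \<in> vecs (Hk H e k). c \<longlonglongrightarrow> 0}"
  then show "c + d \<in> {c \<in> vecs (Hk H e k). c \<longlonglongrightarrow> 0}"
    using tendsto_add[of c 0 sequentially d 0] Hk.vecs_add[of c d] by (simp add: plus_fun_def)
next
  fix a c assume "c \<in> {c \<in> vecs (Hk H e k). c \<longlonglongrightarrow> 0}"
  then show "scl (Hk H e k) a c \<in> {c \<in> vecs (Hk H e k). c \<longlonglongrightarrow> 0}"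
    using tendsto_mult_right_zero[of c sequentially a] Hk.vecs_scl[of c a] by (simp add: ell2_simps(2))
qed

lemma null_sequences_not_closed:
  assumes "k \<ge> 1"
  shows "\<not> closedin (vtop (Hk H e k)) {c \<in> vecs (Hk H e k). c \<longlonglongrightarrow> 0}" (is "\<not> closedin _ ?L")
proof
  assume closed: "closedin (vtop (Hk H e k)) ?L"
  have "unit_seq n \<in> ?L" for n
    using unit_seq_Hk[of n] unfolding unit_seq_def[abs_def]
    by (auto intro!: tendsto_eventually eventually_sequentiallyI[of "Suc n"])
  then have "lin (Hk H e k) (range unit_seq) \<subseteq> ?L"
    unfolding lin_def by (intro Hk.span_minimal null_sequences_subspace) blast
  then have "closed_lin (Hk H e k) (range unit_seq) \<subseteq> ?L"
    unfolding closed_lin_def using closed by (rule closure_of_minimal)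
  then have "(\<lambda>n. 1::complex) \<longlonglongrightarrow> 0"
    using const_1_Hk[OF assms] unfolding closed_lin_unit_seq_Hk by blast
  then show False by (simp add: LIMSEQ_const_iff)
qed

end

section \<open>Strict inclusions between the spaces\<close>

context riesz_basis_coords
begin

lemma ell2_psubset_Hk: "vecs ell2 \<subset> vecs (Hk H e 1)"
proof -
  have "(\<lambda>n. 1) \<notin> vecs ell2" by (simp add: ell2_simps summable_const_iff)
  moreover have "(\<lambda>n. 1) \<in> vecs (Hk H e 1)"
    by (simp add: bdiff_const_1 unit_seq_ell2)
  moreover have "vecs ell2 \<subseteq> vecs (Hk H e 1)" using bdiff_ell2 by auto
  ultimately show ?thesis by blast
qed

lemma Hk_psubset_Suc: "vecs (Hk H e j) \<subset> vecs (Hk H e (Suc j))"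
proof -
  \<comment> \<open>The repeated sum of ones grows like a polynomial of degree \<open>j\<close>: its
    \<open>j\<close>-th difference is constant and not square-summable, and one more difference
    leaves a unit vector.\<close>
  define c where "c = (psum ^^ j) (\<lambda>n. 1)"
  have c: "bdiff j c = (\<lambda>n. 1)" by (simp add: c_def bdiff_psum)
  have "c \<notin> vecs (Hk H e j)" by (simp add: c ell2_simps summable_const_iff)
  moreover have "c \<in> vecs (Hk H e (Suc j))"
    by (simp add: bdiff_Suc[of j] c bdiff_const_1 unit_seq_ell2)
  moreover have "vecs (Hk H e j) \<subseteq> vecs (Hk H e (Suc j))"
    using bdiff_ell2 by (auto simp: bdiff_Suc[of j])
  ultimately show ?thesis by blast
qed

section \<open>Biorthogonal systems\<close>

text \<open>The \<open>n\<close>-th coefficient is a bounded functional of the vector, and its Riesz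
  representative is the dual vector. Density of the span of \<open>e\<close> gives
  uniqueness.\<close>

lemma biorthogonal_unique_exists: "\<exists>!f. biorthogonal H e f"
proof -
  have "\<exists>z\<in>vecs H. \<forall>x\<in>vecs H. X x n = cip H x z" for n
  proof -
    have "cmod (X x n) \<le> K * vnorm H x" if "x \<in> vecs H" for x
      using cmod_le_vnorm_ell2[OF coords.map_vecs[OF that], of n] coords.upper[OF that] by linarith
    then obtain z where "z \<in> vecs H" "\<And>x. x \<in> vecs H \<Longrightarrow> X x n = cip H x z"
      using Riesz_representation[of "\<lambda>x. X x n" K]
      by (auto simp: coords.map_add coords.map_scl ell2_simps(2))
    then show ?thesis by blast
  qed
  then obtain f where f: "\<And>n. f n \<in> vecs H" "\<And>n x. x \<in> vecs H \<Longrightarrow> X x n = cip H x (f n)"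
    by metis
  have "biorthogonal H e f"
    using f(1) by (auto simp: biorthogonal_def f(2)[symmetric] e_vecs X_e unit_seq_def)
  moreover have "g = f" if g: "biorthogonal H e g" for g
  proof
    fix n
    have "g n - f n = 0"
      using g f(1) e_vecs \<open>biorthogonal H e f\<close>
      by (intro eq_0_of_orthogonal[of "range e"] closed_lin_e)
        (auto simp: vecs_diff cip_diff_right biorthogonal_def)
    then show "g n = f n" by simp
  qed
  ultimately show ?thesis by blast
qed

text \<open>Biorthogonality prescribes the products only on the basis. Both sides of the coefficient
  formula are bounded functionals of \<open>v\<close>, so it extends to all of
  \<open>H\<close>.\<close>

lemma dual_system:
  shows "dual_system H e n \<in> vecs H"
    and "v \<in> vecs H \<Longrightarrow> cip H v (dual_system H e n) = X v n"
proof -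
  have b: "biorthogonal H e (dual_system H e)"
    unfolding dual_system_def using biorthogonal_unique_exists by (rule theI')
  then show d: "dual_system H e n \<in> vecs H" by (simp add: biorthogonal_def)
  assume v: "v \<in> vecs H"
  have "cip H v (dual_system H e n) - X v n = 0"
  proof (rule bounded_functional_vanish[where \<phi> = "\<lambda>v. cip H v (dual_system H e n) - X v n"
        and S = "range e" and K = "vnorm H (dual_system H e n) + K"])
    fix y assume y: "y \<in> vecs H"
    have "cmod (cip H y (dual_system H e n) - X y n) \<le> cmod (cip H y (dual_system H e n)) + cmod (X y n)"
      by (rule norm_triangle_ineq4)
    also have "\<dots> \<le> vnorm H y * vnorm H (dual_system H e n) + K * vnorm H y"
      using Cauchy_Schwarz[OF y d] cmod_le_vnorm_ell2[OF coords.map_vecs[OF y], of n] coords.upper[OF y]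
      by linarith
    finally show "cmod (cip H y (dual_system H e n) - X y n) \<le> (vnorm H (dual_system H e n) + K) * vnorm H y"
      by (simp add: algebra_simps)
  next
    fix y assume "y \<in> range e"
    then show "cip H y (dual_system H e n) - X y n = 0"
      using b by (auto simp: biorthogonal_def X_e unit_seq_def)
  qed (use v d e_vecs closed_lin_e in
      \<open>auto simp: cip_add_left cip_scl_left coords.map_add coords.map_scl ell2_simps(2) algebra_simps\<close>)
  then show "cip H v (dual_system H e n) = X v n" by simp
qed

end

section \<open>The shift operator, its adjoint and the dual system\<close>

locale shift_operator = formal_series_space H u X K L e k
  for H :: "'a::ab_group_add cips" and u X K L e k +
  fixes T :: "'a \<Rightarrow> 'a"
  assumes T: "bounded_op H H T"
    and T_e: "T (e n) = e (Suc n)"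
begin

lemma T_vecs: "x \<in> vecs H \<Longrightarrow> T x \<in> vecs H"
  using T by (auto simp: bounded_op_def linear_map_def)

text \<open>On \<open>e m\<close> both sides are \<open>unit_seq m - unit_seq (Suc m)\<close>.
  Fixing an entry \<open>n\<close> reduces the extension to all \<open>x\<close> to a scalar bounded
  functional.\<close>

lemma X_diff_T:
  assumes x: "x \<in> vecs H"
  shows "X (x - T x) = bdiff (Suc 0) (X x)"
proof
  fix n
  obtain C where C: "\<And>x. x \<in> vecs H \<Longrightarrow> vnorm H (T x) \<le> C * vnorm H x"
    using T by (auto simp: bounded_op_def)
  have linear: "linear_map H H T" using T by (simp add: bounded_op_def)
  have "(X (x - T x) - bdiff (Suc 0) (X x)) n = 0"
  proof (rule bounded_functional_vanish[where \<phi> = "\<lambda>x. (X (x - T x) - bdiff (Suc 0) (X x)) n"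
        \<comment> \<open>The first summand bounds \<open>X\<close> after \<open>x - T x\<close>,
          the second the first difference after \<open>X\<close>.\<close>
        and S = "range e" and K = "\<bar>K\<bar> * (1 + C) + 2 * K"])
    fix y assume y: "y \<in> vecs H"
    have vecs: "y - T y \<in> vecs H" "X (y - T y) \<in> vecs ell2" "bdiff (Suc 0) (X y) \<in> vecs ell2"
      using y by (simp_all add: vecs_diff T_vecs coords.map_vecs bdiff_ell2)
    have "cmod ((X (y - T y) - bdiff (Suc 0) (X y)) n) \<le> vnorm ell2 (X (y - T y)) + vnorm ell2 (bdiff (Suc 0) (X y))"
      using cmod_le_vnorm_ell2[OF ell2.vecs_diff[OF vecs(2,3)], of n] ell2.vnorm_triangle[OF vecs(2,3)] by linarith
    moreover have "vnorm H (y - T y) \<le> (1 + C) * vnorm H y"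
      using vnorm_triangle[OF y T_vecs[OF y]] C[OF y] by (simp add: algebra_simps)
    then have "vnorm ell2 (X (y - T y)) \<le> \<bar>K\<bar> * ((1 + C) * vnorm H y)"
      using coords.upper_abs[OF vecs(1)] by (meson abs_ge_zero mult_left_mono order_trans)
    moreover have "vnorm ell2 (bdiff (Suc 0) (X y)) \<le> 2 * (K * vnorm H y)"
      using bdiff_1.upper[OF coords.map_vecs[OF y]] coords.upper[OF y] by linarith
    ultimately show "cmod ((X (y - T y) - bdiff (Suc 0) (X y)) n) \<le> (\<bar>K\<bar> * (1 + C) + 2 * K) * vnorm H y"
      by (simp add: algebra_simps)
  next
    fix y assume "y \<in> range e"
    then obtain m where "y = e m" by auto
    then show "(X (y - T y) - bdiff (Suc 0) (X y)) n = 0"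
      using T_e e_vecs by (cases n) (auto simp: coords.map_diff X_e bdiff_1 unit_seq_def)
  next
    fix y z assume "y \<in> vecs H" "z \<in> vecs H"
    then show "(X (y + z - T (y + z)) - bdiff (Suc 0) (X (y + z))) n =
      (X (y - T y) - bdiff (Suc 0) (X y)) n + (X (z - T z) - bdiff (Suc 0) (X z)) n"
      using linear by (simp add: linear_map_def coords.map_add coords.map_diff vecs_add T_vecs bdiff_add)
  next
    fix a y assume "y \<in> vecs H"
    then show "(X (scl H a y - T (scl H a y)) - bdiff (Suc 0) (X (scl H a y))) n =
      a * (X (y - T y) - bdiff (Suc 0) (X y)) n"
      using linear
      by (simp add: linear_map_def coords.map_scl coords.map_diff vecs_scl T_vecs bdiff_scl_ell2)
        (simp add: ell2_simps(2) algebra_simps)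
  qed (use x e_vecs closed_lin_e in auto)
  then show "X (x - T x) n = bdiff (Suc 0) (X x) n" by simp
qed

lemma diff_T_pow:
  assumes "x \<in> vecs H"
  shows "((\<lambda>x. x - T x) ^^ j) x \<in> vecs H" "X (((\<lambda>x. x - T x) ^^ j) x) = bdiff j (X x)"
proof (induction j)
  case (Suc j)
  case 1
  show ?case using Suc by (simp add: vecs_diff T_vecs)
  case 2
  show ?case using Suc by (simp add: X_diff_T bdiff_Suc[of j])
qed (simp_all add: assms)

lemma adj_diff_op:
  assumes "y \<in> vecs H"
  shows "adj_diff_op H T j y \<in> vecs H"
    and "x \<in> vecs H \<Longrightarrow> cip H x (adj_diff_op H T j y) = cip H (((\<lambda>x. x - T x) ^^ j) x) y"
proof (induction j arbitrary: x)
  case 0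
  case 1
  show ?case using assms by (simp add: adj_diff_op_def)
  case 2
  show ?case by (simp add: adj_diff_op_def)
next
  case (Suc j)
  let ?z = "adj_diff_op H T j y"
  have z: "?z \<in> vecs H" by (rule Suc.IH(1))
  have Suc_eq: "adj_diff_op H T (Suc j) y = ?z - hilbert_adjoint H T ?z"
    by (simp add: adj_diff_op_def)
  case 1
  show ?case unfolding Suc_eq using z T by (intro vecs_diff hilbert_adjoint)
  case 2
  then have "cip H x (adj_diff_op H T (Suc j) y) = cip H (x - T x) ?z"
    using z hilbert_adjoint[OF T z] by (simp add: Suc_eq cip_diff_right cip_diff_left T_vecs)
  also have "\<dots> = cip H (((\<lambda>x. x - T x) ^^ Suc j) x) y"
    \<comment> \<open>The new adjoint factor is applied last on its side and moves over as a factor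
      applied before the others, so the induction hypothesis is used at
      \<open>x - T x\<close>.\<close>
    using Suc.IH(2)[of "x - T x"] 2 by (simp add: vecs_diff T_vecs funpow_Suc_right del: funpow.simps)
  finally show ?case .
qed

text \<open>The kernel of an adjoint is orthogonal to the range of the operator. In coordinates the
  images of the basis are the vectors \<open>bdiff k (unit_seq n)\<close>, whose span is
  dense.\<close>

lemma inj_on_adj_diff_op: "inj_on (adj_diff_op H T k) (vecs H)"
proof (rule inj_onI)
  fix y z assume yz: "y \<in> vecs H" "z \<in> vecs H" "adj_diff_op H T k y = adj_diff_op H T k z"
  let ?S = "range (\<lambda>n. ((\<lambda>x. x - T x) ^^ k) (e n))"
  have S: "?S \<subseteq> vecs H" using diff_T_pow(1)[OF e_vecs] by auto
  have "X ` ?S = bdiff k ` range unit_seq"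
    by (simp add: image_image diff_T_pow(2) e_vecs X_e)
  then have "closed_lin H ?S = vecs H"
    using coords.closed_lin_image_eq_iff[OF S] closed_lin_bdiff_unit_seq by simp
  moreover have "cip H (((\<lambda>x. x - T x) ^^ k) (e n)) (y - z) = 0" for n
    using adj_diff_op(2)[of _ "e n" k] yz diff_T_pow(1)[OF e_vecs] e_vecs
    by (simp add: cip_diff_right flip: adj_diff_op(2))
  ultimately have "y - z = 0"
    using yz S by (intro eq_0_of_orthogonal[of ?S]) (auto simp: vecs_diff)
  then show "y = z" by simp
qed

text \<open>Injectivity alone does not put the dual vector into the range, so a preimage is
  constructed. It must pair with the \<open>k\<close>-th difference of \<open>x\<close> to give
  \<open>X x n\<close>; writing \<open>z\<close> for that difference, the value is the
  \<open>n\<close>-th entry of the repeated sum of \<open>X z\<close>, which is a bounded functional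
  of every \<open>z\<close> in \<open>H\<close>.\<close>

lemma dual_system_preimage:
  obtains w where "w \<in> vecs H" "adj_diff_op H T k w = dual_system H e n"
    "\<And>z. z \<in> vecs H \<Longrightarrow> cip H z w = (psum ^^ k) (X z) n"
proof -
  obtain C where C: "C \<ge> 0" "\<And>c. c \<in> vecs ell2 \<Longrightarrow> cmod ((psum ^^ k) c n) \<le> C * vnorm ell2 c"
    using psum_pow_bounded by blast
  have bound: "cmod ((psum ^^ k) (X z) n) \<le> C * K * vnorm H z" if "z \<in> vecs H" for z
    using C(2)[OF coords.map_vecs[OF that]] mult_left_mono[OF coords.upper[OF that] C(1)] by simp
  obtain w where w: "w \<in> vecs H" "\<And>z. z \<in> vecs H \<Longrightarrow> (psum ^^ k) (X z) n = cip H z w"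
    using Riesz_representation[of "\<lambda>z. (psum ^^ k) (X z) n" "C * K"] bound
    by (auto simp: coords.map_add coords.map_scl psum_pow_add psum_pow_scl ell2_simps(2))
  have "adj_diff_op H T k w = dual_system H e n"
  proof (rule eq_of_cip_eq)
    fix x assume x: "x \<in> vecs H"
    have "cip H x (adj_diff_op H T k w) = (psum ^^ k) (X (((\<lambda>x. x - T x) ^^ k) x)) n"
      using x w diff_T_pow(1) by (simp add: adj_diff_op)
    also have "\<dots> = X x n"
      using x by (simp add: diff_T_pow(2) psum_bdiff)
    finally show "cip H x (adj_diff_op H T k w) = cip H x (dual_system H e n)"
      using x dual_system by simp
  qed (use w adj_diff_op dual_system in auto)
  then show thesis using w that by simp
qed

text \<open>Both inverses in the definition of \<open>chi\<close> are resolved here, the inner one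
  by injectivity on \<open>H\<close> and the outer one by surjectivity of the isometry. Afterwards
  only the resulting product formula is used.\<close>

lemma chi:
  shows "chi H e T k n \<in> vecs (Hk H e k)"
    and "z \<in> vecs H \<Longrightarrow> cip H z (diff_op H e k (chi H e T k n)) = (psum ^^ k) (X z) n"
proof -
  obtain w where w: "w \<in> vecs H" "adj_diff_op H T k w = dual_system H e n"
    "\<And>z. z \<in> vecs H \<Longrightarrow> cip H z w = (psum ^^ k) (X z) n"
    using dual_system_preimage by blast
  have "inv_into (vecs H) (adj_diff_op H T k) (dual_system H e n) = w"
    using inv_into_f_f[OF inj_on_adj_diff_op w(1)] w(2) by simp
  then have chi: "chi H e T k n = inv_into (vecs (Hk H e k)) (diff_op H e k) w"
    by (simp add: chi_def)
  have w_im: "w \<in> diff_op H e k ` vecs (Hk H e k)" using w(1) D.image by simp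
  show "chi H e T k n \<in> vecs (Hk H e k)"
    unfolding chi by (rule inv_into_into[OF w_im])
  show "z \<in> vecs H \<Longrightarrow> cip H z (diff_op H e k (chi H e T k n)) = (psum ^^ k) (X z) n"
    unfolding chi f_inv_into_f[OF w_im] by (rule w(3))
qed

lemma biorthogonal_chi: "biorthogonal (Hk H e k) unit_seq (chi H e T k)"
  unfolding biorthogonal_def
proof (intro conjI allI chi(1))
  fix n m
  have "cip (Hk H e k) (unit_seq n) (chi H e T k m) = (psum ^^ k) (X (diff_op H e k (unit_seq n))) m"
    using D.map_vecs[OF unit_seq_Hk] by (simp add: chi(2))
  also have "\<dots> = unit_seq n m"
    using unit_seq_Hk[of n] by (simp add: diff_op psum_bdiff)
  finally show "cip (Hk H e k) (unit_seq n) (chi H e T k m) = (if n = m then 1 else 0)"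
    by (auto simp: unit_seq_def)
qed

lemma biorthogonal_iff_chi: "biorthogonal (Hk H e k) unit_seq f \<longleftrightarrow> f = chi H e T k"
proof
  assume f: "biorthogonal (Hk H e k) unit_seq f"
  show "f = chi H e T k"
  proof
    fix n
    have f_n: "f n \<in> vecs (Hk H e k)" "\<And>m. cip (Hk H e k) (unit_seq m) (f n) = (if m = n then 1 else 0)"
      using f by (auto simp: biorthogonal_def)
    have chi_n: "cip (Hk H e k) (unit_seq m) (chi H e T k n) = (if m = n then 1 else 0)" for m
      using biorthogonal_chi by (auto simp: biorthogonal_def)
    have "f n - chi H e T k n = 0"
    proof (rule Hk.eq_0_of_orthogonal[OF _ closed_lin_unit_seq_Hk])
      show "f n - chi H e T k n \<in> vecs (Hk H e k)" by (rule Hk.vecs_diff[OF f_n(1) chi(1)])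
      fix s assume "s \<in> range unit_seq"
      then obtain m where "s = unit_seq m" by auto
      then show "cip (Hk H e k) s (f n - chi H e T k n) = 0"
        using Hk.cip_diff_right[OF unit_seq_Hk f_n(1) chi(1)] f_n(2) chi_n by (simp del: Hk_simps)
    qed (use unit_seq_Hk in blast)
    then show "f n = chi H e T k n" by simp
  qed
qed (simp add: biorthogonal_chi)

text \<open>The roles are exchanged: the unit vectors are the partners of \<open>chi\<close>, and
  their norms are bounded uniformly in \<open>n\<close>.\<close>

lemma uniformly_minimal_chi: "uniformly_minimal_seq (Hk H e k) (chi H e T k)"
proof (rule Hk.uniformly_minimal_seqI[OF chi(1) _ vnorm_unit_seq_le])
  show "biorthogonal (Hk H e k) (chi H e T k) unit_seq"
    unfolding biorthogonal_def
  proof (intro conjI allI unit_seq_Hk)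
    fix n m
    have "cip (Hk H e k) (unit_seq m) (chi H e T k n) = (if m = n then 1 else 0)"
      using biorthogonal_chi by (auto simp: biorthogonal_def)
    then show "cip (Hk H e k) (chi H e T k n) (unit_seq m) = (if n = m then 1 else 0)"
      using Hk.cip_commute[OF unit_seq_Hk[of m] chi(1)[of n]] by (auto simp del: Hk_simps)
  qed
qed

end

theorem proposition3:
  fixes H :: "'a::ab_group_add cips"
    and e :: "nat \<Rightarrow> 'a"
    and T :: "'a \<Rightarrow> 'a"
    and k :: nat
  assumes "complex_hilbert_space H"
    and "separable_space (vtop H)"
    and "infinite_dimensional H"
    and "riesz_basis H e"
    and "bounded_op H H T"
    and "\<And>n. T (e n) = e (Suc n)"
    and "k \<ge> 1"
  shows
    "closed_lin (Hk H e k) (range (\<lambda>n. coeff_seq H e (e n))) = vecs (Hk H e k)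

     \<and> \<not> schauder_basis (Hk H e k) (\<lambda>n. coeff_seq H e (e n))

     \<and> ((\<exists>!f. biorthogonal H e f)
        \<and> inj_on (adj_diff_op H T k) (vecs H)
        \<and> (\<forall>n. dual_system H e n \<in> adj_diff_op H T k ` vecs H)
        \<and> bij_betw (diff_op H e k) (vecs (Hk H e k)) (vecs H)
        \<and> (\<forall>f. biorthogonal (Hk H e k) (\<lambda>n. coeff_seq H e (e n)) f \<longleftrightarrow> f = chi H e T k))

     \<and> (uniformly_minimal_seq (Hk H e k) (chi H e T k)
        \<and> minimal_seq (Hk H e k) (\<lambda>n. coeff_seq H e (e n))
        \<and> \<not> uniformly_minimal_seq (Hk H e k) (\<lambda>n. coeff_seq H e (e n)))

     \<and> (coeff_seq H e ` vecs H \<subset> vecs (Hk H e 1)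
        \<and> (\<forall>j\<ge>1. vecs (Hk H e j) \<subset> vecs (Hk H e (Suc j))))

     \<and> (complex_hilbert_space (Hk H e k)
        \<and> separable_space (vtop (Hk H e k))
        \<and> isomorphic (Hk H e k) ell2)

     \<and> (\<exists>u. orthonormal_basis (Hk H e k) u)

     \<and> (module.subspace (scl (Hk H e k)) {c \<in> vecs (Hk H e k). c \<longlonglongrightarrow> 0}
        \<and> \<not> closedin (vtop (Hk H e k)) {c \<in> vecs (Hk H e k). c \<longlonglongrightarrow> 0})"
proof -
  obtain u X K L where coords: "riesz_basis_coords H u X K L e"
    using riesz_basis_coords_exist[OF assms(1,4)] by blast
  interpret shift_operator H u X K L e k T
    using coords assms(5,6)
    by (simp add: shift_operator_def formal_series_space_def shift_operator_axioms_def)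
  \<comment> \<open>This and the next equation replace the identified basis by the unit vectors and
    the identified copy of \<open>H\<close> by \<open>ell2\<close>, the form in which the claims
    were proved.\<close>
  have e: "(\<lambda>n. coeff_seq H e (e n)) = unit_seq"
    by (rule ext) (rule coeff_seq_e)
  have coeff_seq: "coeff_seq H e ` vecs H = vecs ell2"
    using coords.image by (simp add: coeff_seq_eq)
  show ?thesis
    unfolding e coeff_seq
  proof (intro conjI allI impI)
    show "closed_lin (Hk H e k) (range unit_seq) = vecs (Hk H e k)"
      by (rule closed_lin_unit_seq_Hk)
    show "\<not> schauder_basis (Hk H e k) unit_seq"
      by (rule not_schauder_basis_unit_seq[OF assms(7)])
    show "\<exists>!f. biorthogonal H e f" by (rule biorthogonal_unique_exists)
    show "inj_on (adj_diff_op H T k) (vecs H)" by (rule inj_on_adj_diff_op)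
    show "dual_system H e n \<in> adj_diff_op H T k ` vecs H" for n
      by (rule dual_system_preimage[of n]) (metis image_eqI)
    show "bij_betw (diff_op H e k) (vecs (Hk H e k)) (vecs H)" by (rule D.bij)
    show "biorthogonal (Hk H e k) unit_seq f \<longleftrightarrow> f = chi H e T k" for f
      by (rule biorthogonal_iff_chi)
    show "uniformly_minimal_seq (Hk H e k) (chi H e T k)" by (rule uniformly_minimal_chi)
    show "minimal_seq (Hk H e k) unit_seq"
      by (rule Hk.minimal_seqI[OF unit_seq_Hk biorthogonal_chi])
    show "\<not> uniformly_minimal_seq (Hk H e k) unit_seq"
      by (rule not_uniformly_minimal_unit_seq[OF assms(7)])
    show "vecs ell2 \<subset> vecs (Hk H e 1)" by (rule ell2_psubset_Hk)
    show "vecs (Hk H e j) \<subset> vecs (Hk H e (Suc j))" for j by (rule Hk_psubset_Suc)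
    show "complex_hilbert_space (Hk H e k)" by (rule complex_hilbert_space_Hk)
    show "separable_space (vtop (Hk H e k))" using D.separable_iff assms(2) by simp
    show "isomorphic (Hk H e k) ell2" by (rule bd.isomorphic)
    show "\<exists>u. orthonormal_basis (Hk H e k) u" using orthonormal_basis_Hk by blast
    show "module.subspace (scl (Hk H e k)) {c \<in> vecs (Hk H e k). c \<longlonglongrightarrow> 0}"
      by (rule null_sequences_subspace)
    show "\<not> closedin (vtop (Hk H e k)) {c \<in> vecs (Hk H e k). c \<longlonglongrightarrow> 0}"
      by (rule null_sequences_not_closed[OF assms(7)])
  qed
qed

end
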